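(* Let $G:=G_{1}\times G_{2}$ be a product of topological groups, $\mu_{1}$, $\mu_{2}$ Baire probability measures on $G_{1}$ and $G_{2}$, and $(V,\rho)$ a uniformly bounded strongly operator continuous Banach $G$-module. Assume that $(V,\rho|_{G_{1}})$ is weakly uniquely $\mu_{1}$-stationary without almost invariant unit vectors, and that $(V,\rho|_{G_{2}})$ is weakly uniquely $\mu_{2}$-stationary. Then there exists an embedding of topological vector spaces $H_{c}^{1}(G_{1}\times G_{2},V)\hookrightarrow H_{c}^{1}(G_{1},V^{\mu_{2}})\oplus H_{c}^{1}(G_{2},V^{\mu_{1}})$. If furthermore $V^{\mu_{1}}=V^{G_{1}}$ and $V^{\mu_{2}}=V^{G_{2}}$, then the embedding is surjective, i.e. $H_{c}^{1}(G_{1}\times G_{2},V)\cong H_{c}^{1}(G_{1},V^{G_{2}})$.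
   Context: Banach spaces are real or complex; topological groups are not assumed Hausdorff. The Baire $\sigma$-algebra of a topological space $X$ is the smallest $\sigma$-algebra for which all continuous functions $X\to\mathbb{R}$ are measurable; a Baire probability measure on $X$ is a probability measure on it, and $\mathcal{P}_\sigma(X)$ is the set of these. A uniformly bounded Banach $G$-module $(V,\rho)$ is a Banach space $V$ with a group homomorphism $\rho:G\to \mathrm{GL}(V)$, $g\mapsto\rho_g$, into the invertible bounded operators such that $\sup_{g}\Vert\rho_g\Vert<\infty$. It is strongly (resp. weakly) operator continuous if for every $v\in V$ the map $g\mapsto\rho_g(v)$ is continuous for the norm (resp. weak) topology on $V$. $V^G$ is the subspace of vectors fixed by $G$. The module has almost invariant unit vectors if for all compact $K\subseteq G$ and $\varepsilon>0$ there is $v\in V$ with $\Vert v\Vert=1$ and $\Vert v-\rho_g(v)\Vert<\varepsilon$ for all $g\in K$. For $\mu\in\mathcal{P}_\sigma(G)$, $(V,\rho)$ is $\mu$-integrable if it is weakly operator continuous and for every $v\in V$ there is $\rho_\mu(v)\in V$ with $\phi(\rho_\mu(v))=\int_G\phi(\rho_g(v))\,d\mu(g)$ for all $\phi\in V^*$; then $\rho_\mu\in\mathcal{B}(V)$, and $V^\mu:=\{v\in V\mid\rho_\mu(v)=v\}$. $(V,\rho)$ is weakly uniquely $\mu$-stationary if it is uniformly bounded, $\mu$-integrable, and for every non-zero $\phi\in V^*$ with $\phi\circ\rho_\mu=\phi$ there is $v\in V^\mu$ with $\phi(v)\neq0$. In the claim, $V^{\mu_i}$ is formed with respect to $\rho|_{G_i}$;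 since $G_1$ and $G_2$ commute, $V^{\mu_2},V^{G_2}$ are closed $G_1$-invariant subspaces and $V^{\mu_1},V^{G_1}$ are closed $G_2$-invariant subspaces. For a uniformly bounded strongly operator continuous Banach $G$-module $(V,\rho)$, $C^n(G,V)$ is the space of continuous functions $G^n\to V$ (norm topology on $V$) with the compact-open topology, and $C^n(G,V)^G$ is the subspace of $f$ with $f(gg_1,\dots,gg_n)=\rho_g(f(g_1,\dots,g_n))$. Define $\partial^n:C^n(G,V)^G\to C^{n+1}(G,V)^G$ by $(\partial^nf)(g_1,\dots,g_{n+1})=\sum_{i=1}^{n+1}(-1)^{i+1}f(g_1,\dots,\widehat{g}_i,\dots,g_{n+1})$. Set $Z^n(G,V):=\ker(\partial^{n+1})\subseteq C^{n+1}(G,V)^G$, $B^n(G,V):=\mathrm{im}(\partial^n)\subseteq C^{n+1}(G,V)^G$, and $H_c^n(G,V):=Z^n(G,V)/B^n(G,V)$ with the quotient topology. An embedding of topological vector spaces is a linear map that is a homeomorphism onto its image. *)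

theory Defs
  imports "HOL-Analysis.Analysis" "HOL-Probability.Probability_Measure"
begin

text \<open>
  Topological groups are types of class \<^class>\<open>topological_group_add\<close>: the group is written
  additively, but it is neither assumed commutative nor Hausdorff. Definitions that are applied to
  a product of two such types only require the sort \<open>{topological_space, group_add}\<close>, since the
  library does not declare the product as an instance of \<^class>\<open>topological_group_add\<close>.

  The scalar field is a type of sort \<open>{real_normed_field, euclidean_space}\<close>. Both \<^typ>\<open>real\<close> and
  \<^typ>\<open>complex\<close> are instances, and up to isometric isomorphism there are no others: the norm of a
  \<^class>\<open>real_normed_field\<close> is multiplicative, so Gelfand-Mazur applies.
\<close>

section \<open>Banach spaces over the reals or the complex numbers\<close>

locale banach_space = vector_space sc
  for sc :: "'k::{real_normed_field, euclidean_space} \<Rightarrow> 'v::banach \<Rightarrow> 'v" +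
  assumes norm_scale: "norm (sc a v) = norm a * norm v"
    and scale_of_real: "sc (of_real r) v = r *\<^sub>R v"

definition bounded_operator :: "('k::real_normed_field \<Rightarrow> 'v::real_normed_vector \<Rightarrow> 'v) \<Rightarrow> ('v \<Rightarrow> 'v) \<Rightarrow> bool"
  where "bounded_operator sc A \<longleftrightarrow> bounded_linear A \<and> (\<forall>a v. A (sc a v) = sc a (A v))"

definition continuous_dual :: "('k::real_normed_field \<Rightarrow> 'v::real_normed_vector \<Rightarrow> 'v) \<Rightarrow> ('v \<Rightarrow> 'k) set"
  where "continuous_dual sc = {\<phi>. bounded_linear \<phi> \<and> (\<forall>a v. \<phi> (sc a v) = a * \<phi> v)}"

definition weak_topology :: "('k::real_normed_field \<Rightarrow> 'v::real_normed_vector \<Rightarrow> 'v) \<Rightarrow> 'v topology"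
  where "weak_topology sc =
    topology_generated_by {\<phi> -` U | \<phi> U. \<phi> \<in> continuous_dual sc \<and> open U}"

section \<open>Baire probability measures\<close>

definition baire_algebra :: "'x::topological_space measure"
  where "baire_algebra =
    sigma UNIV {f -` B | (f :: 'x \<Rightarrow> real) B. continuous_on UNIV f \<and> B \<in> sets borel}"

definition baire_prob :: "'x::topological_space measure \<Rightarrow> bool"
  where "baire_prob \<mu> \<longleftrightarrow> prob_space \<mu> \<and> sets \<mu> = sets baire_algebra"

section \<open>Banach modules\<close>

text \<open>Invertibility of each \<open>\<rho> g\<close> is a consequence of \<open>\<rho> 0 = id\<close> and multiplicativity.\<close>

definition ub_module :: "('k::real_normed_field \<Rightarrow> 'v::banach \<Rightarrow> 'v) \<Rightarrow> ('g::group_add \<Rightarrow> 'v \<Rightarrow> 'v) \<Rightarrow> bool"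
  where "ub_module sc \<rho> \<longleftrightarrow>
    (\<forall>g. bounded_operator sc (\<rho> g)) \<and> \<rho> 0 = id \<and> (\<forall>g h. \<rho> (g + h) = \<rho> g \<circ> \<rho> h) \<and>
    bdd_above (range (\<lambda>g. onorm (\<rho> g)))"

definition strongly_continuous :: "('g::topological_space \<Rightarrow> 'v::banach \<Rightarrow> 'v) \<Rightarrow> bool"
  where "strongly_continuous \<rho> \<longleftrightarrow> (\<forall>v. continuous_on UNIV (\<lambda>g. \<rho> g v))"

definition weakly_continuous ::
    "('k::real_normed_field \<Rightarrow> 'v::banach \<Rightarrow> 'v) \<Rightarrow> ('g::topological_space \<Rightarrow> 'v \<Rightarrow> 'v) \<Rightarrow> bool"
  where "weakly_continuous sc \<rho> \<longleftrightarrow>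
    (\<forall>v. continuous_map euclidean (weak_topology sc) (\<lambda>g. \<rho> g v))"

abbreviation restrict_fst :: "('g \<times> 'h::zero \<Rightarrow> 'v \<Rightarrow> 'v) \<Rightarrow> 'g \<Rightarrow> 'v \<Rightarrow> 'v"
  where "restrict_fst \<rho> \<equiv> \<lambda>g. \<rho> (g, 0)"

abbreviation restrict_snd :: "('g::zero \<times> 'h \<Rightarrow> 'v \<Rightarrow> 'v) \<Rightarrow> 'h \<Rightarrow> 'v \<Rightarrow> 'v"
  where "restrict_snd \<rho> \<equiv> \<lambda>h. \<rho> (0, h)"

definition fixed_vectors :: "('g \<Rightarrow> 'v \<Rightarrow> 'v) \<Rightarrow> 'v set"
  where "fixed_vectors \<rho> = {v. \<forall>g. \<rho> g v = v}"

definition almost_invariant_unit_vectors :: "('g::topological_space \<Rightarrow> 'v::banach \<Rightarrow> 'v) \<Rightarrow> bool"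
  where "almost_invariant_unit_vectors \<rho> \<longleftrightarrow>
    (\<forall>K \<epsilon>. compact K \<longrightarrow> \<epsilon> > 0 \<longrightarrow> (\<exists>v. norm v = 1 \<and> (\<forall>g\<in>K. norm (v - \<rho> g v) < \<epsilon>)))"

definition weak_average ::
    "('k::{real_normed_field, euclidean_space} \<Rightarrow> 'v::banach \<Rightarrow> 'v) \<Rightarrow> 'g measure \<Rightarrow> ('g \<Rightarrow> 'v \<Rightarrow> 'v)
      \<Rightarrow> 'v \<Rightarrow> 'v \<Rightarrow> bool"
  where "weak_average sc \<mu> \<rho> v w \<longleftrightarrow>
    (\<forall>\<phi>\<in>continuous_dual sc. \<phi> w = (\<integral>g. \<phi> (\<rho> g v) \<partial>\<mu>))"

definition mu_integrable ::
    "('k::{real_normed_field, euclidean_space} \<Rightarrow> 'v::banach \<Rightarrow> 'v) \<Rightarrow> 'g::topological_space measure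
      \<Rightarrow> ('g \<Rightarrow> 'v \<Rightarrow> 'v) \<Rightarrow> bool"
  where "mu_integrable sc \<mu> \<rho> \<longleftrightarrow>
    weakly_continuous sc \<rho> \<and> (\<forall>v. \<exists>w. weak_average sc \<mu> \<rho> v w)"

text \<open>The weak average is unique by Hahn-Banach, so the description below is meaningful for every
  integrable module.\<close>

definition mu_operator ::
    "('k::{real_normed_field, euclidean_space} \<Rightarrow> 'v::banach \<Rightarrow> 'v) \<Rightarrow> 'g measure \<Rightarrow> ('g \<Rightarrow> 'v \<Rightarrow> 'v)
      \<Rightarrow> 'v \<Rightarrow> 'v"
  where "mu_operator sc \<mu> \<rho> v = (THE w. weak_average sc \<mu> \<rho> v w)"

definition stationary_vectors ::
    "('k::{real_normed_field, euclidean_space} \<Rightarrow> 'v::banach \<Rightarrow> 'v) \<Rightarrow> 'g measure \<Rightarrow> ('g \<Rightarrow> 'v \<Rightarrow> 'v) \<Rightarrow> 'v set"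
  where "stationary_vectors sc \<mu> \<rho> = {v. mu_operator sc \<mu> \<rho> v = v}"

definition weakly_uniquely_stationary ::
    "('k::{real_normed_field, euclidean_space} \<Rightarrow> 'v::banach \<Rightarrow> 'v)
      \<Rightarrow> 'g::{topological_space, group_add} measure \<Rightarrow> ('g \<Rightarrow> 'v \<Rightarrow> 'v) \<Rightarrow> bool"
  where "weakly_uniquely_stationary sc \<mu> \<rho> \<longleftrightarrow>
    ub_module sc \<rho> \<and> mu_integrable sc \<mu> \<rho> \<and>
    (\<forall>\<phi>\<in>continuous_dual sc. \<phi> \<noteq> (\<lambda>_. 0) \<longrightarrow> \<phi> \<circ> mu_operator sc \<mu> \<rho> = \<phi> \<longrightarrow>
      (\<exists>v\<in>stationary_vectors sc \<mu> \<rho>. \<phi> v \<noteq> 0))"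

section \<open>Topological vector spaces with a carrier\<close>

text \<open>The carrier of a structure \<open>E\<close> is \<open>topspace (tvs_top E)\<close>; the operations are only
  meaningful there.\<close>

record ('k, 'x) tvs =
  tvs_top :: "'x topology"
  tvs_add :: "'x \<Rightarrow> 'x \<Rightarrow> 'x"
  tvs_scale :: "'k \<Rightarrow> 'x \<Rightarrow> 'x"

abbreviation tvs_carrier :: "('k, 'x) tvs \<Rightarrow> 'x set"
  where "tvs_carrier E \<equiv> topspace (tvs_top E)"

definition tvs_linear :: "('k, 'x) tvs \<Rightarrow> ('k, 'y) tvs \<Rightarrow> ('x \<Rightarrow> 'y) \<Rightarrow> bool"
  where "tvs_linear E F T \<longleftrightarrow>
    T ` tvs_carrier E \<subseteq> tvs_carrier F \<and>
    (\<forall>x\<in>tvs_carrier E. \<forall>y\<in>tvs_carrier E. T (tvs_add E x y) = tvs_add F (T x) (T y)) \<and>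
    (\<forall>a. \<forall>x\<in>tvs_carrier E. T (tvs_scale E a x) = tvs_scale F a (T x))"

definition tvs_embedding :: "('k, 'x) tvs \<Rightarrow> ('k, 'y) tvs \<Rightarrow> ('x \<Rightarrow> 'y) \<Rightarrow> bool"
  where "tvs_embedding E F T \<longleftrightarrow> tvs_linear E F T \<and> embedding_map (tvs_top E) (tvs_top F) T"

definition tvs_isomorphic :: "('k, 'x) tvs \<Rightarrow> ('k, 'y) tvs \<Rightarrow> bool"
  where "tvs_isomorphic E F \<longleftrightarrow>
    (\<exists>T. tvs_linear E F T \<and> homeomorphic_map (tvs_top E) (tvs_top F) T)"

definition tvs_sum :: "('k, 'x) tvs \<Rightarrow> ('k, 'y) tvs \<Rightarrow> ('k, 'x \<times> 'y) tvs"
  where "tvs_sum E F =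
    \<lparr>tvs_top = prod_topology (tvs_top E) (tvs_top F),
     tvs_add = (\<lambda>x y. (tvs_add E (fst x) (fst y), tvs_add F (snd x) (snd y))),
     tvs_scale = (\<lambda>a x. (tvs_scale E a (fst x), tvs_scale F a (snd x)))\<rparr>"

definition quotient_topology :: "'a topology \<Rightarrow> ('a \<Rightarrow> 'b) \<Rightarrow> 'b topology"
  where "quotient_topology X q =
    topology (\<lambda>U. U \<subseteq> q ` topspace X \<and> openin X {x \<in> topspace X. q x \<in> U})"

lemma openin_quotient_topology:
  "openin (quotient_topology X q) U \<longleftrightarrow>
    U \<subseteq> q ` topspace X \<and> openin X {x \<in> topspace X. q x \<in> U}"
proof -
  have "istopology (\<lambda>U. U \<subseteq> q ` topspace X \<and> openin X {x \<in> topspace X. q x \<in> U})"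
    unfolding istopology_def
  proof (intro conjI allI impI)
    fix S T
    assume "S \<subseteq> q ` topspace X \<and> openin X {x \<in> topspace X. q x \<in> S}"
      and "T \<subseteq> q ` topspace X \<and> openin X {x \<in> topspace X. q x \<in> T}"
    moreover have "{x \<in> topspace X. q x \<in> S \<inter> T} =
        {x \<in> topspace X. q x \<in> S} \<inter> {x \<in> topspace X. q x \<in> T}"
      by blast
    ultimately show "S \<inter> T \<subseteq> q ` topspace X" "openin X {x \<in> topspace X. q x \<in> S \<inter> T}"
      by (auto simp only: openin_Int)
  next
    fix \<K>
    assume *: "\<forall>K\<in>\<K>. K \<subseteq> q ` topspace X \<and> openin X {x \<in> topspace X. q x \<in> K}"
    then show "\<Union>\<K> \<subseteq> q ` topspace X" by blast
    have "{x \<in> topspace X. q x \<in> \<Union>\<K>} = (\<Union>K\<in>\<K>. {x \<in> topspace X. q x \<in> K})"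
      by blast
    with * show "openin X {x \<in> topspace X. q x \<in> \<Union>\<K>}" by auto
  qed
  then show ?thesis unfolding quotient_topology_def by simp
qed

lemma quotient_map_quotient_topology: "quotient_map X (quotient_topology X q) q"
proof -
  have "topspace (quotient_topology X q) = q ` topspace X"
  proof
    show "topspace (quotient_topology X q) \<subseteq> q ` topspace X"
      using openin_quotient_topology by (metis openin_topspace)
    have "{x \<in> topspace X. q x \<in> q ` topspace X} = topspace X" by blast
    then show "q ` topspace X \<subseteq> topspace (quotient_topology X q)"
      by (intro openin_subset) (simp add: openin_quotient_topology)
  qed
  then show ?thesis by (auto simp: quotient_map_def openin_quotient_topology)
qed

section \<open>Continuous cohomology\<close>

text \<open>
  The power \<open>G^n\<close> consists of the extensional functions on \<open>{..<n}\<close>, so the arguments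
  \<open>g_1, \<dots>, g_n\<close> are numbered from \<open>0\<close>. The coefficients are a subset \<open>W\<close> of the ambient space
  \<^typ>\<open>'v\<close>, in applications a closed subspace invariant under \<open>\<rho>\<close>. Cochains vanish outside \<open>G^n\<close>,
  so that they correspond bijectively to functions on \<open>G^n\<close> and form a vector space pointwise.
\<close>

definition power_topology :: "nat \<Rightarrow> (nat \<Rightarrow> 'g::topological_space) topology"
  where "power_topology n = product_topology (\<lambda>_. euclidean) {..<n}"

definition cochains :: "nat \<Rightarrow> 'v::banach set \<Rightarrow> ((nat \<Rightarrow> 'g::topological_space) \<Rightarrow> 'v) set"
  where "cochains n W =
    {f. continuous_map (power_topology n) (top_of_set W) f \<and>
        (\<forall>x. x \<notin> topspace (power_topology n) \<longrightarrow> f x = 0)}"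

definition compact_open_topology ::
    "nat \<Rightarrow> 'v::banach set \<Rightarrow> ((nat \<Rightarrow> 'g::topological_space) \<Rightarrow> 'v) topology"
  where "compact_open_topology n W =
    topology_generated_by
      {{f \<in> cochains n W. f ` K \<subseteq> U} | K U. compactin (power_topology n) K \<and> open U}"

definition inv_cochains ::
    "nat \<Rightarrow> 'v::banach set \<Rightarrow> ('g::{topological_space, group_add} \<Rightarrow> 'v \<Rightarrow> 'v)
      \<Rightarrow> ((nat \<Rightarrow> 'g) \<Rightarrow> 'v) set"
  where "inv_cochains n W \<rho> =
    {f \<in> cochains n W. \<forall>g. \<forall>x \<in> topspace (power_topology n).
       f (\<lambda>j\<in>{..<n}. g + x j) = \<rho> g (f x)}"

definition delete_entry :: "nat \<Rightarrow> nat \<Rightarrow> (nat \<Rightarrow> 'g) \<Rightarrow> nat \<Rightarrow> 'g"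
  where "delete_entry n i x = (\<lambda>j\<in>{..<n}. if j < i then x j else x (Suc j))"

definition coboundary ::
    "nat \<Rightarrow> ((nat \<Rightarrow> 'g::topological_space) \<Rightarrow> 'v::banach) \<Rightarrow> (nat \<Rightarrow> 'g) \<Rightarrow> 'v"
  where "coboundary n f x =
    (if x \<in> topspace (power_topology (Suc n))
     then \<Sum>i<Suc n. (- 1) ^ i *\<^sub>R f (delete_entry n i x) else 0)"

definition cocycles ::
    "nat \<Rightarrow> 'v::banach set \<Rightarrow> ('g::{topological_space, group_add} \<Rightarrow> 'v \<Rightarrow> 'v)
      \<Rightarrow> ((nat \<Rightarrow> 'g) \<Rightarrow> 'v) set"
  where "cocycles n W \<rho> = {f \<in> inv_cochains (Suc n) W \<rho>. coboundary (Suc n) f = (\<lambda>_. 0)}"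

definition coboundaries ::
    "nat \<Rightarrow> 'v::banach set \<Rightarrow> ('g::{topological_space, group_add} \<Rightarrow> 'v \<Rightarrow> 'v)
      \<Rightarrow> ((nat \<Rightarrow> 'g) \<Rightarrow> 'v) set"
  where "coboundaries n W \<rho> = coboundary n ` inv_cochains n W \<rho>"

text \<open>
  The elements of the cohomology space are the cosets of the coboundaries in the cocycles.
  Adding the coboundaries back in the scalar multiplication makes it correct for the scalar \<open>0\<close>.
  In degree \<open>0\<close> the formula for the coboundaries includes \<open>G^0\<close>, so it gives a
  reduced version there; all positive degrees are the usual ones.
\<close>

definition cohomology ::
    "('k::real_normed_field \<Rightarrow> 'v::banach \<Rightarrow> 'v) \<Rightarrow> nat \<Rightarrow> 'v set
      \<Rightarrow> ('g::{topological_space, group_add} \<Rightarrow> 'v \<Rightarrow> 'v) \<Rightarrow> ('k, ((nat \<Rightarrow> 'g) \<Rightarrow> 'v) set) tvs"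
  where "cohomology sc n W \<rho> =
    \<lparr>tvs_top = quotient_topology (subtopology (compact_open_topology (Suc n) W) (cocycles n W \<rho>))
       (\<lambda>f. {\<lambda>x. f x + b x | b. b \<in> coboundaries n W \<rho>}),
     tvs_add = (\<lambda>P Q. {\<lambda>x. p x + q x | p q. p \<in> P \<and> q \<in> Q}),
     tvs_scale = (\<lambda>a P. {\<lambda>x. sc a (p x) + b x | p b. p \<in> P \<and> b \<in> coboundaries n W \<rho>})\<rparr>"

end

theory Submission
  imports Defs
begin

text \<open>
  Let \<open>P\<close> be the mean ergodic projection onto the \<open>\<mu>\<^sub>2\<close>-stationary vectors; it exists because weak
  unique stationarity says that the stationary vectors and the range of \<open>\<rho>\<^sub>\<mu> - 1\<close> for \<open>\<mu> = \<mu>\<^sub>2\<close> span a dense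
  subspace, and it lies in the strong operator closure of the convex hull of \<open>\<rho>(G\<^sub>2)\<close>.
  A 1-cocycle is a crossed homomorphism \<open>b\<close>, and since \<open>G\<^sub>1\<close> and \<open>G\<^sub>2\<close> commute,
  \<open>(\<rho>(h) - 1) b(g) = (\<rho>(g) - 1) b(h)\<close> for \<open>g\<close> in \<open>G\<^sub>1\<close> and \<open>h\<close> in \<open>G\<^sub>2\<close>. Hence, for every average
  \<open>R\<close> of the operators \<open>\<rho>(h)\<close>, the crossed homomorphism \<open>(R - 1) b\<close> on \<open>G\<^sub>1\<close> is principal. As \<open>G\<^sub>1\<close>
  has no almost invariant unit vectors, this passes to the limit: \<open>(P - 1) b\<close> is principal on \<open>G\<^sub>1\<close>,
  so every class has a representative with \<open>b = P b\<close> on \<open>G\<^sub>1\<close>. The same identity shows that \<open>b\<close> is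
  determined by, and continuously dependent on, its restriction to \<open>G\<^sub>1\<close>. So \<open>b \<mapsto> P b\<close>, restricted
  to \<open>G\<^sub>1\<close>, already embeds the cohomology of the product in the first summand.
\<close>

section \<open>Convex separation\<close>

text \<open>Two obstacles shape the proof. The operator of a measure is known only through
  functionals, while the cocycle identity is averaged here over finite convex combinations. A
  Hahn-Banach separation of finite tuples of vectors therefore places this operator in the strong
  operator closure of the convex hull of the action. The same membership bounds all its powers by
  the one constant \<open>C\<close>, where a norm bound alone would give \<open>C ^ n\<close>, and
  this is what the mean ergodic argument runs on. Secondly, cochain spaces over an arbitrary group
  need not be metrizable. Limits of the vectors that trivialise \<open>(R - 1) b\<close> are taken
  on one compact set at a time and glued by uniqueness. Continuity of the inverse is a direct
  estimate: with a gap \<epsilon> on a compact set \<open>K\<close>, the values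
  \<open>b (0, h)\<close> are controlled, uniformly in \<open>h\<close>, by the values
  \<open>b (k, 0)\<close> with \<open>k\<close> in \<open>K\<close>.\<close>

definition sublinear :: "('a::real_vector \<Rightarrow> real) \<Rightarrow> bool"
  where "sublinear q \<longleftrightarrow>
    (\<forall>x y. q (x + y) \<le> q x + q y) \<and> (\<forall>t x. t \<ge> 0 \<longrightarrow> q (t *\<^sub>R x) = t * q x)"

lemma sublinearI:
  assumes "\<And>x y. q (x + y) \<le> q x + q y" and "q 0 = 0"
    and "\<And>t x. t > 0 \<Longrightarrow> q (t *\<^sub>R x) \<le> t * q x"
  shows "sublinear q"
proof -
  have "q (t *\<^sub>R x) = t * q x" if "t \<ge> 0" for t x
  proof (cases "t = 0")
    case False
    with that have "t > 0" by simp
    have "q ((1 / t) *\<^sub>R (t *\<^sub>R x)) \<le> (1 / t) * q (t *\<^sub>R x)"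
      by (rule assms(3)) (use \<open>t > 0\<close> in simp)
    then have "t * q x \<le> q (t *\<^sub>R x)"
      using \<open>t > 0\<close> by (simp add: field_simps)
    with assms(3)[OF \<open>t > 0\<close>, of x] show ?thesis by simp
  qed (use assms(2) in simp)
  then show ?thesis using assms(1) by (simp add: sublinear_def)
qed

lemma sublinear_add: "sublinear q \<Longrightarrow> q (x + y) \<le> q x + q y"
  and sublinear_scale: "sublinear q \<Longrightarrow> t \<ge> 0 \<Longrightarrow> q (t *\<^sub>R x) = t * q x"
  by (simp_all add: sublinear_def)

lemma sublinear_zero: "sublinear q \<Longrightarrow> q 0 = 0"
  using sublinear_scale[of q 0 0] by simp

lemma sublinear_minus: "sublinear q \<Longrightarrow> - q (- x) \<le> q x"
  using sublinear_add[of q x "- x"] sublinear_zero[of q] by simp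

text \<open>A minimal sublinear functional is linear, so Zorn's lemma applied downwards replaces the
  extension of a functional one dimension at a time. Pointwise infima of chains stay finite because
  each member \<open>c\<close> satisfies \<open>- p (- x) \<le> c x\<close>.\<close>

lemma minimal_sublinear_below:
  assumes p: "sublinear p"
  obtains q where "sublinear q" "\<And>x. q x \<le> p x"
    "\<And>r. sublinear r \<Longrightarrow> (\<And>x. r x \<le> q x) \<Longrightarrow> r = q"
proof -
  define A where "A = {q. sublinear q \<and> (\<forall>x. q x \<le> p x)}"
  \<comment> \<open>The order is reversed, so that the maximal element given by Zorn's lemma is a
    minimal functional.\<close>
  define P where "P = (\<lambda>a b :: 'a \<Rightarrow> real. \<forall>x. b x \<le> a x)"
  have "partial_order_on A (relation_of P A)"
    unfolding partial_order_on_def preorder_on_def refl_on_def trans_def antisym_def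
      relation_of_def P_def
    by (auto intro: order_trans intro!: ext antisym)
  moreover have "\<exists>u\<in>A. \<forall>a\<in>C. P a u" if C: "C \<in> Chains (relation_of P A)" for C
  proof (cases "C = {}")
    case True
    then show ?thesis using p by (auto simp: A_def)
  next
    case False
    have CA: "C \<subseteq> A" and chain: "\<And>a b. a \<in> C \<Longrightarrow> b \<in> C \<Longrightarrow> P a b \<or> P b a"
      using C by (auto simp: Chains_def relation_of_def)
    define u where "u = (\<lambda>x. INF c\<in>C. c x)"
    have lower: "- p (- x) \<le> c x" if "c \<in> C" for c x
    proof -
      have "sublinear c" "c (- x) \<le> p (- x)" using that CA by (auto simp: A_def)
      then show ?thesis using sublinear_minus[of c x] by linarith
    qed
    have bdd: "bdd_below ((\<lambda>c. c x) ` C)" for x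
      by (rule bdd_belowI2[of _ "- p (- x)"]) (rule lower)
    have le: "u x \<le> c x" if "c \<in> C" for c x
      unfolding u_def by (rule cINF_lower[OF bdd that])
    have greatest: "m \<le> u x" if "\<And>c. c \<in> C \<Longrightarrow> m \<le> c x" for m x
      unfolding u_def by (rule cINF_greatest[OF False that])
    have sub: "sublinear c" if "c \<in> C" for c using that CA by (auto simp: A_def)
    have "sublinear u"
    proof (rule sublinearI)
      fix x y
      \<comment> \<open>One functional has to serve both arguments; in a chain the smaller of
        \<open>c\<close> and \<open>d\<close> does.\<close>
      have two: "u (x + y) \<le> c x + d y" if c: "c \<in> C" and d: "d \<in> C" for c d
      proof (cases "P c d")
        case True
        then have "d x \<le> c x" by (simp add: P_def)
        then show ?thesis
          using le[OF d, of "x + y"] sublinear_add[OF sub[OF d], of x y] by linarith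
      next
        case False
        with chain[OF c d] have "P d c" by blast
        then have "c y \<le> d y" by (simp add: P_def)
        then show ?thesis
          using le[OF c, of "x + y"] sublinear_add[OF sub[OF c], of x y] by linarith
      qed
      have "u (x + y) - c x \<le> u y" if "c \<in> C" for c
        by (rule greatest) (use two[OF that] in \<open>force simp: algebra_simps\<close>)
      then have "u (x + y) - u y \<le> u x"
        by (intro greatest) (force simp: algebra_simps)
      then show "u (x + y) \<le> u x + u y" by simp
    next
      show "u 0 = 0"
        unfolding u_def using False by (simp add: sublinear_zero[OF sub] cong: INF_cong)
    next
      fix t :: real and x assume t: "t > 0"
      have "u (t *\<^sub>R x) / t \<le> u x"
      proof (rule greatest)
        fix c assume "c \<in> C"
        then show "u (t *\<^sub>R x) / t \<le> c x"
          using le[of c "t *\<^sub>R x"] sublinear_scale[OF sub, of c t x] t by (simp add: field_simps)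
      qed
      then show "u (t *\<^sub>R x) \<le> t * u x" using t by (simp add: field_simps)
    qed
    moreover have "u x \<le> p x" for x
      using False CA le by (force simp: A_def intro: order_trans)
    ultimately show ?thesis using le by (auto simp: A_def P_def)
  qed
  ultimately obtain q where q: "q \<in> A" "\<forall>a\<in>A. P q a \<longrightarrow> a = q"
    using predicate_Zorn[of A P] by blast
  show thesis
  proof
    show "sublinear q" "\<And>x. q x \<le> p x" using q(1) by (auto simp: A_def)
    fix r assume r: "sublinear r" "\<And>x. r x \<le> q x"
    moreover have "q x \<le> p x" for x using q(1) by (simp add: A_def)
    ultimately have "r \<in> A" unfolding A_def using order_trans by blast
    then show "r = q" using q(2) r(2) by (simp add: P_def)
  qed
qed

text \<open>Used twice: with a singleton \<open>D\<close> it shows that minimal sublinear functionals are linear,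
  and with general \<open>D\<close> it builds the separation into the functional one starts from.\<close>

lemma sublinear_shift:
  assumes q: "sublinear q" and D: "convex D" and low: "\<And>y. y \<in> D \<Longrightarrow> d \<le> q y"
    and ne: "D \<noteq> {}"
  obtains r where "sublinear r" "\<And>x. r x \<le> q x" "\<And>y. y \<in> D \<Longrightarrow> r (- y) \<le> - d"
proof -
  \<comment> \<open>The infimum \<open>r\<close> below is the largest sublinear functional under
    \<open>q\<close> that is at most \<open>- d\<close> on the negatives of \<open>D\<close>: any
    such \<open>r'\<close> has
    \<open>r' x \<le> r' (x + t *\<^sub>R y) + t * r' (- y)\<close>.\<close>
  define I where "I = {0::real..} \<times> D"
  define g where "g = (\<lambda>x (t, y). q (x + t *\<^sub>R y) - t * d)"
  define r where "r = (\<lambda>x. INF i\<in>I. g x i)"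
  have "I \<noteq> {}" using ne by (auto simp: I_def)
  have lower: "- q (- x) \<le> g x i" if i: "i \<in> I" for i x
  proof -
    obtain t y where ty: "i = (t, y)" "t \<ge> 0" "y \<in> D" using i by (auto simp: I_def)
    have "t * q y \<le> q (x + t *\<^sub>R y) + q (- x)"
      using sublinear_add[OF q, of "x + t *\<^sub>R y" "- x"] sublinear_scale[OF q ty(2), of y] by simp
    moreover have "t * d \<le> t * q y" using ty low by (simp add: mult_left_mono)
    ultimately show ?thesis by (simp add: g_def ty)
  qed
  have bdd: "bdd_below (g x ` I)" for x
    by (rule bdd_belowI2[of _ "- q (- x)"]) (rule lower)
  have le: "r x \<le> q (x + t *\<^sub>R y) - t * d" if "t \<ge> 0" "y \<in> D" for x t y
    using cINF_lower[OF bdd, of "(t, y)" x] that by (simp add: r_def I_def g_def)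
  have greatest: "m \<le> r x" if "\<And>t y. t \<ge> 0 \<Longrightarrow> y \<in> D \<Longrightarrow> m \<le> q (x + t *\<^sub>R y) - t * d" for m x
    unfolding r_def by (rule cINF_greatest[OF \<open>I \<noteq> {}\<close>]) (use that in \<open>auto simp: I_def g_def\<close>)
  obtain y0 where y0: "y0 \<in> D" using ne by blast
  have rq: "r x \<le> q x" for x using le[of 0 y0 x] y0 by simp
  have "sublinear r"
  proof (rule sublinearI)
    fix x y
    have two: "r (x + y) \<le> (q (x + s *\<^sub>R u) - s * d) + (q (y + t *\<^sub>R v) - t * d)"
      if "s \<ge> 0" "u \<in> D" "t \<ge> 0" "v \<in> D" for s u t v
    proof (cases "s + t = 0")
      case True
      then have "s = 0" "t = 0" using that by auto
      then show ?thesis using rq[of "x + y"] sublinear_add[OF q, of x y] by simp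
    next
      case False
      with that have pos: "s + t > 0" by linarith
      \<comment> \<open>By convexity of \<open>D\<close> the two shifts merge into a single shift of
        length \<open>s + t\<close>.\<close>
      define w where "w = (s / (s + t)) *\<^sub>R u + (t / (s + t)) *\<^sub>R v"
      have "w \<in> D" unfolding w_def
        by (rule convexD[OF D]) (use that pos in \<open>auto simp: add_divide_distrib[symmetric]\<close>)
      moreover have "(s + t) *\<^sub>R w = s *\<^sub>R u + t *\<^sub>R v"
        using False by (simp add: w_def scaleR_add_right)
      ultimately have "r (x + y) \<le> q ((x + s *\<^sub>R u) + (y + t *\<^sub>R v)) - (s + t) * d"
        using le[of "s + t" w "x + y"] pos by (simp add: algebra_simps)
      then show ?thesis
        using sublinear_add[OF q, of "x + s *\<^sub>R u" "y + t *\<^sub>R v"] by (simp add: algebra_simps)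
    qed
    have "r (x + y) - (q (x + s *\<^sub>R u) - s * d) \<le> r y" if "s \<ge> 0" "u \<in> D" for s u
      by (rule greatest) (use two[OF that] in \<open>force simp: algebra_simps\<close>)
    then have "r (x + y) - r y \<le> r x"
      by (intro greatest) (force simp: algebra_simps)
    then show "r (x + y) \<le> r x + r y" by simp
  next
    have "0 \<le> r 0"
    proof (rule greatest)
      fix t :: real and y assume ty: "t \<ge> 0" "y \<in> D"
      then show "0 \<le> q (0 + t *\<^sub>R y) - t * d"
        using low[of y] sublinear_scale[OF q, of t y] by (simp add: mult_left_mono)
    qed
    then show "r 0 = 0" using rq[of 0] sublinear_zero[OF q] by simp
  next
    fix t :: real and x assume t: "t > 0"
    have "r (t *\<^sub>R x) / t \<le> r x"
    proof (rule greatest)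
      fix s :: real and y assume sy: "s \<ge> 0" "y \<in> D"
      have "r (t *\<^sub>R x) \<le> q (t *\<^sub>R x + (t * s) *\<^sub>R y) - (t * s) * d"
        by (rule le) (use t sy in auto)
      also have "t *\<^sub>R x + (t * s) *\<^sub>R y = t *\<^sub>R (x + s *\<^sub>R y)"
        by (simp add: scaleR_add_right)
      finally show "r (t *\<^sub>R x) / t \<le> q (x + s *\<^sub>R y) - s * d"
        using t sublinear_scale[OF q, of t "x + s *\<^sub>R y"] by (simp add: field_simps)
    qed
    then show "r (t *\<^sub>R x) \<le> t * r x" using t by (simp add: field_simps)
  qed
  moreover have "r (- y) \<le> - d" if "y \<in> D" for y
    using le[of 1 y "- y"] that sublinear_zero[OF q] by simp
  ultimately show thesis using rq that by blast
qed

lemma linear_below_sublinear: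
  assumes p: "sublinear p"
  obtains f where "linear f" "\<And>x. f x \<le> p x"
proof -
  obtain q where q: "sublinear q" "\<And>x. q x \<le> p x"
    and min: "\<And>r. sublinear r \<Longrightarrow> (\<And>x. r x \<le> q x) \<Longrightarrow> r = q"
    using minimal_sublinear_below[OF p] by blast
  have neg: "q (- y) = - q y" for y
  proof -
    obtain r where "sublinear r" "\<And>x. r x \<le> q x" "\<And>z. z \<in> {y} \<Longrightarrow> r (- z) \<le> - q y"
      by (rule sublinear_shift[OF q(1), of "{y}" "q y"]) auto
    with min[of r] have "q (- y) \<le> - q y" by auto
    then show ?thesis using sublinear_minus[OF q(1), of y] by simp
  qed
  have "linear q"
  proof (rule linearI)
    fix x y
    have "q x \<le> q (x + y) + q (- y)" using sublinear_add[OF q(1), of "x + y" "- y"] by simp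
    then show "q (x + y) = q x + q y"
      using sublinear_add[OF q(1), of x y] by (simp add: neg)
  next
    fix t x
    show "q (t *\<^sub>R x) = t *\<^sub>R q x"
    proof (cases "t \<ge> 0")
      case False
      then have "q (t *\<^sub>R x) = - q ((- t) *\<^sub>R x)" using neg[of "(- t) *\<^sub>R x"] by simp
      then show ?thesis using False sublinear_scale[OF q(1), of "- t" x] by simp
    qed (use sublinear_scale[OF q(1)] in simp)
  qed
  with q(2) show thesis using that by blast
qed

text \<open>The distance condition is exactly what lets the norm be shifted by \<open>D\<close>; a
  linear functional below the shifted norm then separates with the same constant \<open>d\<close>
  and has norm at most 1.\<close>

lemma convex_separation:
  fixes D :: "'a::real_normed_vector set"
  assumes "convex D" and "\<And>y. y \<in> D \<Longrightarrow> d \<le> norm y"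
  shows "\<exists>f :: 'a \<Rightarrow> real. bounded_linear f \<and> (\<forall>x. f x \<le> norm x) \<and> (\<forall>y\<in>D. d \<le> f y)"
proof (cases "D = {}")
  case True
  then show ?thesis using bounded_linear_zero by (intro exI[of _ "\<lambda>_. 0"]) auto
next
  case False
  have "sublinear (norm :: 'a \<Rightarrow> real)" by (simp add: sublinear_def norm_triangle_ineq)
  then obtain p where p: "sublinear p" "\<And>x::'a. p x \<le> norm x" "\<And>y. y \<in> D \<Longrightarrow> p (- y) \<le> - d"
    using sublinear_shift[of norm D d] assms False by blast
  obtain f where f: "linear f" "\<And>x. f x \<le> p x" using linear_below_sublinear[OF p(1)] by blast
  have up: "f x \<le> norm x" for x using f(2) p(2) order_trans by blast
  then have "norm (f x) \<le> norm x" for x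
    using up[of x] up[of "- x"] linear_neg[OF f(1), of x] by (simp add: abs_le_iff)
  then have "bounded_linear f"
    using f(1) by (intro bounded_linear_intro[of f 1]) (auto simp: linear_add linear_scale)
  moreover have "d \<le> f y" if "y \<in> D" for y
    using f(2)[of "- y"] p(3)[OF that] linear_neg[OF f(1), of y] by linarith
  ultimately show ?thesis using up by blast
qed

corollary separating_functional:
  fixes x :: "'a::real_normed_vector"
  assumes "subspace W" and "x \<notin> closure W"
  obtains f :: "'a \<Rightarrow> real" where "bounded_linear f" "\<And>w. w \<in> W \<Longrightarrow> f w = 0" "f x > 0"
proof -
  obtain d where d: "d > 0" "\<And>w. w \<in> W \<Longrightarrow> d \<le> dist w x"
    using assms(2) by (force simp: closure_approachable not_less)
  have conv: "convex ((\<lambda>w. x + w) ` W)" using assms(1) subspace_imp_convex convex_translation by blast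
  have low: "d \<le> norm y" if y: "y \<in> (\<lambda>w. x + w) ` W" for y
  proof -
    obtain w where w: "w \<in> W" "y = x + w" using y by blast
    then show ?thesis
      using d(2)[of "- w"] subspace_neg[OF assms(1) w(1)] by (simp add: dist_norm norm_minus_commute)
  qed
  obtain f where f: "bounded_linear f" "\<And>y. y \<in> (\<lambda>w. x + w) ` W \<Longrightarrow> d \<le> f y"
    using convex_separation[OF conv low] by blast
  interpret bounded_linear f by fact
  have ge: "d \<le> f x + t * f w" if "w \<in> W" for t w
    using f(2)[of "x + t *\<^sub>R w"] subspace_scale[OF assms(1) that] by (auto simp: add scaleR)
  have "f w = 0" if "w \<in> W" for w
  proof (rule ccontr)
    assume "f w \<noteq> 0"
    \<comment> \<open>With this coefficient \<open>f x + t * f w\<close> equals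
      \<open>d - 1\<close>, below the lower bound \<open>d\<close>.\<close>
    then show False
      using ge[OF that, of "(d - 1 - f x) / f w"] by simp
  qed
  moreover have "f x > 0" using ge[OF subspace_0[OF assms(1)], of 0] d(1) zero by simp
  ultimately show thesis using that f(1) by blast
qed

section \<open>Functionals over the scalar field\<close>

lemma (in banach_space) bounded_linear_scale: "bounded_linear (sc a)"
  by (rule bounded_linear_intro[of _ "norm a"])
    (simp_all add: scale_right_distrib norm_scale mult.commute flip: scale_of_real)

text \<open>Over the reals \<open>\<Phi> = \<phi>\<close>; over the complex numbers \<open>\<phi>\<close> is the real part of \<open>\<Phi>\<close>.\<close>

lemma scalar_functional:
  fixes sc :: "'k::{real_normed_field, euclidean_space} \<Rightarrow> 'v::banach \<Rightarrow> 'v"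
  assumes "banach_space sc" and \<phi>: "bounded_linear (\<phi> :: 'v \<Rightarrow> real)"
  obtains \<Phi> where "\<Phi> \<in> continuous_dual sc" "\<And>a v. inner (a * \<Phi> v) 1 = \<phi> (sc a v)"
proof -
  interpret banach_space sc by fact
  interpret \<phi>: bounded_linear \<phi> by fact
  have sc_lin: "linear (\<lambda>a. sc a v)" for v
    by (rule linearI) (simp_all add: scale_left_distrib scaleR_conv_of_real scale_of_real
        flip: scale_scale)
  \<comment> \<open>The form \<open>inner (a * c) 1\<close> is nondegenerate because nonzero scalars
    are invertible. \<open>S\<close> represents it by the inner product, so its inverse turns the
    Riesz vector \<open>u v\<close> of \<open>a \<mapsto> \<phi> (sc a v)\<close> into the required
    scalar.\<close>
  define S :: "'k \<Rightarrow> 'k" where "S = (\<lambda>c. \<Sum>i\<in>Basis. inner (i * c) 1 *\<^sub>R i)"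
  have S_inner: "inner a (S c) = inner (a * c) 1" for a c
  proof -
    have "inner a (S c) = (\<Sum>i\<in>Basis. inner a i * inner (i * c) 1)"
      by (simp add: S_def inner_sum_right mult.commute)
    also have "\<dots> = inner ((\<Sum>i\<in>Basis. inner a i *\<^sub>R i) * c) 1"
      by (simp add: sum_distrib_right inner_sum_left)
    finally show ?thesis by (simp add: euclidean_representation)
  qed
  have "linear S"
    by (rule linearI)
      (simp_all add: S_def algebra_simps inner_add_left sum.distrib scaleR_sum_right)
  moreover have "inj S"
  proof (subst linear_injective_0[OF \<open>linear S\<close>], intro allI impI)
    fix c assume "S c = 0"
    then have "inner (inverse c * c) 1 = 0" using S_inner[of "inverse c" c] by simp
    then show "c = 0" by (cases "c = 0") auto
  qed
  ultimately obtain S' where S': "linear S'" "\<And>c. S (S' c) = c"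
    using linear_injective_isomorphism by metis
  define u where "u = (\<lambda>v. \<Sum>i\<in>Basis. \<phi> (sc i v) *\<^sub>R i)"
  have u_inner: "inner a (u v) = \<phi> (sc a v)" for a v
  proof -
    have "inner a (u v) = (\<Sum>i\<in>Basis. inner a i * \<phi> (sc i v))"
      by (simp add: u_def inner_sum_right mult.commute)
    also have "\<dots> = \<phi> (sc (\<Sum>i\<in>Basis. inner a i *\<^sub>R i) v)"
      by (simp add: linear_sum[OF sc_lin] linear_scale[OF sc_lin] \<phi>.sum \<phi>.scaleR)
    finally show ?thesis by (simp add: euclidean_representation)
  qed
  define \<Phi> where "\<Phi> = (\<lambda>v. S' (u v))"
  have key: "inner (a * \<Phi> v) 1 = \<phi> (sc a v)" for a v
    using S_inner[of a "\<Phi> v"] u_inner[of a v] by (simp add: \<Phi>_def S')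
  have eqI: "x = y" if "\<And>a. inner (a * x) 1 = inner (a * y) 1" for x y :: 'k
    by (metis S_inner inner_commute injD[OF \<open>inj S\<close>] that vector_eq_rdot)
  have "bounded_linear u"
    unfolding u_def
    by (intro bounded_linear_sum bounded_linear_scaleR_left[THEN bounded_linear_compose]
        bounded_linear_compose[OF \<phi> bounded_linear_scale])
  then have "bounded_linear \<Phi>"
    unfolding \<Phi>_def using S'(1) bounded_linear_compose linear_conv_bounded_linear by blast
  moreover have "\<Phi> (sc b v) = b * \<Phi> v" for b v
    by (rule eqI) (simp add: key flip: mult.assoc)
  ultimately have "\<Phi> \<in> continuous_dual sc" by (simp add: continuous_dual_def)
  then show thesis using key that by blast
qed

section \<open>Strong operator closures\<close>

text \<open>Written out by basic neighbourhoods, since the topology carried by the operator type is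
  that of the norm.\<close>

definition sot_closure :: "('v::real_normed_vector \<Rightarrow>\<^sub>L 'v) set \<Rightarrow> ('v \<Rightarrow>\<^sub>L 'v) set"
  where "sot_closure S =
    {T. \<forall>F \<delta>. finite F \<longrightarrow> \<delta> > 0 \<longrightarrow> (\<exists>R\<in>S. \<forall>v\<in>F. norm (blinfun_apply R v - blinfun_apply T v) < \<delta>)}"

lemma sot_closureD:
  fixes T :: "'v::real_normed_vector \<Rightarrow>\<^sub>L 'v"
  assumes "T \<in> sot_closure S" "finite F" "\<delta> > 0"
  obtains R where "R \<in> S" "\<And>v. v \<in> F \<Longrightarrow> norm (blinfun_apply R v - T v) < \<delta>"
proof -
  have "\<exists>R\<in>S. \<forall>v\<in>F. norm (blinfun_apply R v - T v) < \<delta>"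
    using assms by (simp add: sot_closure_def)
  then show thesis using that by blast
qed

lemma sot_closure_superset: "S \<subseteq> sot_closure S"
  by (force simp: sot_closure_def)

lemma sot_closure_convex:
  assumes "convex S"
  shows "convex (sot_closure S)"
proof (rule convexI)
  fix T U and a b :: real
  assume T: "T \<in> sot_closure S" and U: "U \<in> sot_closure S" and ab: "0 \<le> a" "0 \<le> b" "a + b = 1"
  have "\<exists>R\<in>S. \<forall>v\<in>F. norm (blinfun_apply R v - (a *\<^sub>R T + b *\<^sub>R U) v) < \<delta>" if F: "finite F" "\<delta> > 0" for F \<delta>
  proof -
    obtain R where R: "R \<in> S" "\<And>v. v \<in> F \<Longrightarrow> norm (blinfun_apply R v - T v) < \<delta>"
      using sot_closureD[OF T F] by blast
    obtain Q where Q: "Q \<in> S" "\<And>v. v \<in> F \<Longrightarrow> norm (blinfun_apply Q v - U v) < \<delta>"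
      using sot_closureD[OF U F] by blast
    have "norm ((a *\<^sub>R R + b *\<^sub>R Q) v - (a *\<^sub>R T + b *\<^sub>R U) v) < \<delta>" if v: "v \<in> F" for v
    proof -
      have "R v - T v \<in> ball 0 \<delta>" "Q v - U v \<in> ball 0 \<delta>" using R(2)[OF v] Q(2)[OF v] by simp_all
      then have "a *\<^sub>R (R v - T v) + b *\<^sub>R (Q v - U v) \<in> ball 0 \<delta>"
        using convexD[OF convex_ball] ab by blast
      then show ?thesis by (simp add: blinfun.bilinear_simps algebra_simps)
    qed
    moreover have "a *\<^sub>R R + b *\<^sub>R Q \<in> S" using convexD[OF assms R(1) Q(1) ab] .
    ultimately show ?thesis by blast
  qed
  then show "a *\<^sub>R T + b *\<^sub>R U \<in> sot_closure S" by (simp add: sot_closure_def)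
qed

lemma sot_closure_limit:
  fixes T :: "nat \<Rightarrow> 'v::real_normed_vector \<Rightarrow>\<^sub>L 'v" and U :: "'v \<Rightarrow>\<^sub>L 'v"
  assumes T: "\<And>n. T n \<in> sot_closure S" and lim: "\<And>v. (\<lambda>n. T n v) \<longlonglongrightarrow> U v"
  shows "U \<in> sot_closure S"
proof -
  have "\<exists>R\<in>S. \<forall>v\<in>F. norm (blinfun_apply R v - U v) < \<delta>" if F: "finite F" "\<delta> > 0" for F \<delta>
  proof -
    have "\<forall>\<^sub>F n in sequentially. dist (T n v) (U v) < \<delta> / 2" for v
      using tendstoD[OF lim, of "\<delta> / 2"] F(2) by simp
    then have "\<forall>\<^sub>F n in sequentially. \<forall>v\<in>F. dist (T n v) (U v) < \<delta> / 2"
      by (simp add: eventually_ball_finite F(1))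
    then obtain n where n: "\<And>v. v \<in> F \<Longrightarrow> dist (T n v) (U v) < \<delta> / 2"
      unfolding eventually_sequentially by blast
    obtain R where R: "R \<in> S" "\<And>v. v \<in> F \<Longrightarrow> norm (blinfun_apply R v - T n v) < \<delta> / 2"
      using sot_closureD[OF T F(1), of "\<delta> / 2"] F(2) by auto
    have "norm (R v - U v) < \<delta>" if "v \<in> F" for v
      using R(2)[OF that] n[OF that] norm_triangle_lt[of "R v - T n v" "T n v - U v" \<delta>]
      by (simp add: dist_norm)
    then show ?thesis using R(1) by blast
  qed
  then show ?thesis by (simp add: sot_closure_def)
qed

lemma sot_closure_bound:
  fixes T :: "'v::real_normed_vector \<Rightarrow>\<^sub>L 'v"
  assumes T: "T \<in> sot_closure S" and S: "\<And>R v. R \<in> S \<Longrightarrow> norm (blinfun_apply R v) \<le> C * norm v"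
  shows "norm (T v) \<le> C * norm v"
proof (rule field_le_epsilon)
  fix \<delta> :: real assume "\<delta> > 0"
  then obtain R where "R \<in> S" "norm (blinfun_apply R v - T v) < \<delta>"
    using sot_closureD[OF T, of "{v}" \<delta>] by auto
  then show "norm (T v) \<le> C * norm v + \<delta>"
    using S[of R v] norm_triangle_ineq3[of "R v" "T v"] by linarith
qed

lemma sot_closure_commute:
  fixes T :: "'v::real_normed_vector \<Rightarrow>\<^sub>L 'v"
  assumes T: "T \<in> sot_closure S" and B: "bounded_linear B"
    and comm: "\<And>R v. R \<in> S \<Longrightarrow> blinfun_apply R (B v) = B (blinfun_apply R v)"
  shows "T (B v) = B (T v)"
proof -
  obtain c where c: "c > 0" "\<And>x. norm (B x) \<le> norm x * c"
    using bounded_linear.pos_bounded[OF B] by blast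
  have "norm (T (B v) - B (T v)) \<le> 0"
  proof (rule field_le_epsilon)
    fix \<delta> :: real assume "\<delta> > 0"
    \<comment> \<open>Two errors have to fit into \<delta>: the one at \<open>B v\<close>, and the
      one at \<open>v\<close> magnified by the bound \<open>c\<close> of \<open>B\<close>.\<close>
    then have "\<delta> / (1 + c) > 0" using c(1) by simp
    then obtain R where R: "R \<in> S" "\<And>x. x \<in> {v, B v} \<Longrightarrow> norm (blinfun_apply R x - T x) < \<delta> / (1 + c)"
      using sot_closureD[OF T, of "{v, B v}" "\<delta> / (1 + c)"] by auto
    have "norm (B (R v - T v)) \<le> norm (R v - T v) * c" by (rule c(2))
    also have "\<dots> \<le> \<delta> / (1 + c) * c" using R(2)[of v] c(1) by (intro mult_right_mono) auto
    finally have "norm (B (R v - T v)) \<le> \<delta> / (1 + c) * c" .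
    moreover have eq: "T (B v) - B (T v) = B (R v - T v) - (R (B v) - T (B v))"
      using comm[OF R(1), of v] B by (simp add: bounded_linear.linear linear_diff)
    moreover have "\<delta> / (1 + c) * c + \<delta> / (1 + c) = \<delta>"
    proof -
      have "\<delta> / (1 + c) * c + \<delta> / (1 + c) = \<delta> / (1 + c) * (1 + c)" by (simp add: distrib_left)
      then show ?thesis using c(1) by simp
    qed
    moreover have "norm (R (B v) - T (B v)) < \<delta> / (1 + c)" by (rule R(2)) simp
    moreover have "norm (T (B v) - B (T v)) \<le> norm (B (R v - T v)) + norm (R (B v) - T (B v))"
      unfolding eq by (rule norm_triangle_ineq4)
    ultimately show "norm (T (B v) - B (T v)) \<le> 0 + \<delta>" by linarith
  qed
  then show ?thesis by simp
qed

text \<open>Composition is jointly continuous for the strong topology on bounded sets: the error of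
  \<open>Q\<close> is magnified by at most \<open>C\<close>, whichever \<open>R\<close> was chosen.
  The denominator uses \<open>C + 1\<close> because \<open>C\<close> may be 0.\<close>

lemma sot_closure_compose:
  fixes T U :: "'v::real_normed_vector \<Rightarrow>\<^sub>L 'v"
  assumes T: "T \<in> sot_closure S" and U: "U \<in> sot_closure S"
    and S: "\<And>R v. R \<in> S \<Longrightarrow> norm (blinfun_apply R v) \<le> C * norm v" and C: "C \<ge> 0"
    and mult: "\<And>R Q. R \<in> S \<Longrightarrow> Q \<in> S \<Longrightarrow> R o\<^sub>L Q \<in> S"
  shows "T o\<^sub>L U \<in> sot_closure S"
proof -
  have "\<exists>R\<in>S. \<forall>v\<in>F. norm (blinfun_apply R v - (T o\<^sub>L U) v) < \<delta>" if F: "finite F" "\<delta> > 0" for F \<delta>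
  proof -
    obtain R where R: "R \<in> S" "\<And>v. v \<in> blinfun_apply U ` F \<Longrightarrow> norm (blinfun_apply R v - T v) < \<delta> / 2"
      using sot_closureD[OF T, of "blinfun_apply U ` F" "\<delta> / 2"] F by auto
    have "\<delta> / (2 * (C + 1)) > 0" using F C by simp
    then obtain Q where Q: "Q \<in> S" "\<And>v. v \<in> F \<Longrightarrow> norm (blinfun_apply Q v - U v) < \<delta> / (2 * (C + 1))"
      using sot_closureD[OF U F(1)] by auto
    have "norm ((R o\<^sub>L Q) v - (T o\<^sub>L U) v) < \<delta>" if v: "v \<in> F" for v
    proof -
      have "norm (R (Q v - U v)) \<le> C * norm (Q v - U v)" by (rule S[OF R(1)])
      also have "\<dots> \<le> C * (\<delta> / (2 * (C + 1)))" using Q(2)[OF v] C by (intro mult_left_mono) auto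
      also have "\<dots> \<le> \<delta> / 2" using C F(2) by (simp add: field_simps)
      finally have "norm (R (Q v - U v)) \<le> \<delta> / 2" .
      moreover have "norm (R (U v) - T (U v)) < \<delta> / 2" using R(2) v by blast
      ultimately show ?thesis
        using norm_triangle_ineq[of "R (Q v - U v)" "R (U v) - T (U v)"]
        by (simp add: blinfun.bilinear_simps)
    qed
    then show ?thesis using mult[OF R(1) Q(1)] by blast
  qed
  then show ?thesis by (simp add: sot_closure_def)
qed

text \<open>The bound makes \<open>S\<close> equicontinuous, so closeness on a finite net of
  \<open>K\<close> spreads to all of \<open>K\<close>. The radius \<eta> leaves a third of \<delta>
  each for moving \<open>R\<close>, moving \<open>T\<close>, and the error on the net.\<close>

lemma sot_closure_uniform_on_compact:
  fixes T :: "'v::real_normed_vector \<Rightarrow>\<^sub>L 'v"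
  assumes T: "T \<in> sot_closure S" and S: "\<And>R v. R \<in> S \<Longrightarrow> norm (blinfun_apply R v) \<le> C * norm v"
    and C: "C \<ge> 0" and K: "compact K" and \<delta>: "\<delta> > 0"
  shows "\<exists>R\<in>S. \<forall>v\<in>K. norm (blinfun_apply R v - T v) < \<delta>"
proof -
  define \<eta> where "\<eta> = \<delta> / (3 * (C + 1))"
  have \<eta>: "\<eta> > 0" "C * \<eta> \<le> \<delta> / 3" using \<delta> C by (simp_all add: \<eta>_def field_simps)
  obtain F where F: "finite F" "K \<subseteq> (\<Union>x\<in>F. ball x \<eta>)"
    using K \<eta>(1) seq_compact_imp_totally_bounded compact_imp_seq_compact by metis
  obtain R where R: "R \<in> S" "\<And>v. v \<in> F \<Longrightarrow> norm (blinfun_apply R v - T v) < \<delta> / 3"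
    using sot_closureD[OF T F(1), of "\<delta> / 3"] \<delta> by auto
  have "norm (R v - T v) < \<delta>" if v: "v \<in> K" for v
  proof -
    obtain x where x: "x \<in> F" "norm (v - x) < \<eta>"
      using F(2) v by (auto simp: dist_norm norm_minus_commute)
    have "norm (R (v - x)) \<le> C * norm (v - x)" "norm (T (v - x)) \<le> C * norm (v - x)"
      using S[OF R(1)] sot_closure_bound[OF T S] by blast+
    moreover have "C * norm (v - x) \<le> \<delta> / 3"
      using mult_left_mono[of "norm (v - x)" \<eta> C] x(2) C \<eta>(2) by linarith
    moreover have "norm (R v - T v) \<le> norm (R (v - x)) + norm (T (v - x)) + norm (R x - T x)"
    proof -
      have "R v - T v = (R (v - x) - T (v - x)) + (R x - T x)"
        by (simp add: blinfun.bilinear_simps)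
      then show ?thesis
        using norm_triangle_ineq[of "R (v - x) - T (v - x)" "R x - T x"]
          norm_triangle_ineq4[of "R (v - x)" "T (v - x)"] by simp
    qed
    ultimately show ?thesis using R(2)[OF x(1)] by linarith
  qed
  with R(1) show ?thesis by blast
qed

section \<open>Averages over a uniformly bounded module\<close>

lemma ub_module_bound:
  assumes "ub_module sc \<rho>"
  obtains C where "C \<ge> 1" "\<And>g v. norm (\<rho> g v) \<le> C * norm v"
proof
  \<comment> \<open>The maximum with 1 allows later estimates to divide by \<open>C\<close>.\<close>
  define C where "C = max 1 (SUP g. onorm (\<rho> g))"
  show "C \<ge> 1" by (simp add: C_def)
  fix g v
  have "bounded_linear (\<rho> g)" using assms by (simp add: ub_module_def bounded_operator_def)
  then have "norm (\<rho> g v) \<le> onorm (\<rho> g) * norm v" by (rule onorm)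
  moreover have "onorm (\<rho> g) \<le> C"
    using assms cSUP_upper[of g UNIV "\<lambda>g. onorm (\<rho> g)"] by (simp add: ub_module_def C_def)
  ultimately show "norm (\<rho> g v) \<le> C * norm v"
    by (meson mult_right_mono norm_ge_zero order_trans)
qed

text \<open>Tuples of any finite length are placed in one normed space, the bounded sequences with
  the supremum norm, where the separation theorem applies to them.\<close>

definition at_index :: "nat \<Rightarrow> 'v::real_normed_vector \<Rightarrow> nat \<Rightarrow>\<^sub>C 'v"
  where "at_index i v = Bcontfun (\<lambda>j. if j = i then v else 0)"

lemma apply_at_index [simp]: "at_index i v j = (if j = i then v else 0)"
proof -
  have "(\<lambda>j. if j = i then v else 0) \<in> bcontfun"
    by (rule bcontfun_normI[of _ "norm v"]) auto
  then show ?thesis by (simp add: at_index_def Bcontfun_inverse)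
qed

lemma bounded_linear_at_index: "bounded_linear (at_index i)"
  by (rule bounded_linear_intro[of _ 1])
    (auto intro!: bcontfun_eqI norm_bound simp del: norm_bounded)

lemma apply_bcontfun_sum: "apply_bcontfun (\<Sum>i\<in>I. f i) x = (\<Sum>i\<in>I. f i x)"
  by (induction I rule: infinite_finite_induct) auto

text \<open>The Baire algebra is generated by real-valued functions, so scalar-valued ones are
  treated coordinate by coordinate.\<close>

lemma baire_measurable_continuous:
  fixes f :: "'g::topological_space \<Rightarrow> 'k::euclidean_space"
  assumes "sets \<mu> = sets (baire_algebra :: 'g measure)" "continuous_on UNIV f"
  shows "f \<in> borel_measurable \<mu>"
proof -
  have "(\<lambda>x. f x \<bullet> i) \<in> borel_measurable \<mu>" for i
  proof (rule measurableI)
    fix B :: "real set" assume B: "B \<in> sets borel"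
    have "continuous_on UNIV (\<lambda>x. f x \<bullet> i)" by (intro continuous_intros assms(2))
    then have "(\<lambda>x. f x \<bullet> i) -` B \<in> sets (baire_algebra :: 'g measure)"
      using B unfolding baire_algebra_def by (auto intro!: sigma_sets.Basic)
    moreover have "space \<mu> = UNIV"
      using sets_eq_imp_space_eq[OF assms(1)] by (simp add: baire_algebra_def)
    ultimately show "(\<lambda>x. f x \<bullet> i) -` B \<inter> space \<mu> \<in> sets \<mu>" by (simp add: assms(1))
  qed simp
  then show ?thesis using borel_measurable_euclidean_space[of f \<mu>] by blast
qed

locale averaged_module = banach_space sc
  for sc :: "'k::{real_normed_field, euclidean_space} \<Rightarrow> 'v::banach \<Rightarrow> 'v" +
  fixes \<mu> :: "'g::{topological_space, group_add} measure" and \<rho> :: "'g \<Rightarrow> 'v \<Rightarrow> 'v" and C :: real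
  assumes baire: "baire_prob \<mu>"
    and cont: "strongly_continuous \<rho>"
    and stationary: "weakly_uniquely_stationary sc \<mu> \<rho>"
    and C_ge_1: "C \<ge> 1"
    and bound: "norm (\<rho> g v) \<le> C * norm v"
begin

lemma ub: "ub_module sc \<rho>"
  using stationary by (simp add: weakly_uniquely_stationary_def)

lemma bounded_linear_action: "bounded_linear (\<rho> g)"
  using ub by (simp add: ub_module_def bounded_operator_def)

lemma action_scale: "\<rho> g (sc a v) = sc a (\<rho> g v)"
  using ub by (simp add: ub_module_def bounded_operator_def)

lemma action_plus: "\<rho> (g + h) v = \<rho> g (\<rho> h v)"
  using ub by (simp add: ub_module_def)

lemma action_zero: "\<rho> 0 v = v"
  using ub by (simp add: ub_module_def)

definition averages :: "('v \<Rightarrow>\<^sub>L 'v) set"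
  where "averages = convex hull (range (\<lambda>g. Blinfun (\<rho> g)))"

lemma apply_Blinfun_action [simp]: "blinfun_apply (Blinfun (\<rho> g)) = \<rho> g"
  by (rule bounded_linear_Blinfun_apply[OF bounded_linear_action])

lemma action_in_averages: "Blinfun (\<rho> g) \<in> averages"
  unfolding averages_def by (rule hull_inc) blast

lemma averages_convex: "convex averages"
  by (simp add: averages_def)

lemma averages_induct:
  assumes "R \<in> averages" "convex {R. Q R}" "\<And>g. Q (Blinfun (\<rho> g))"
  shows "Q R"
proof -
  have "averages \<subseteq> {R. Q R}"
    unfolding averages_def by (rule hull_minimal) (use assms in auto)
  then show ?thesis using assms(1) by blast
qed

lemma averages_bound: "R \<in> averages \<Longrightarrow> norm (R v) \<le> C * norm v"
proof -
  assume "R \<in> averages"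
  then have "R \<in> cball 0 C"
  proof (rule averages_induct)
    fix g
    show "Blinfun (\<rho> g) \<in> cball 0 C"
      using C_ge_1 bound by (auto intro!: norm_blinfun_bound)
  next
    show "convex {R. R \<in> cball (0 :: 'v \<Rightarrow>\<^sub>L 'v) C}" by (simp only: Collect_mem_eq convex_cball)
  qed
  then have "norm R * norm v \<le> C * norm v" by (simp add: mult_right_mono)
  then show ?thesis using norm_blinfun[of R v] by linarith
qed

text \<open>Composition is affine in each factor, so two convexity inductions reduce the claim to
  \<open>\<rho> g \<circ> \<rho> h = \<rho> (g + h)\<close>.\<close>

lemma averages_compose:
  assumes R: "R \<in> averages" and Q: "Q \<in> averages"
  shows "R o\<^sub>L Q \<in> averages"
proof -
  have left: "R' o\<^sub>L Blinfun (\<rho> h) \<in> averages" if "R' \<in> averages" for R' h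
    using that
  proof (rule averages_induct)
    have "linear (\<lambda>R. R o\<^sub>L Blinfun (\<rho> h))"
      by (intro bounded_linear.linear bounded_bilinear.bounded_linear_left
          bounded_bilinear_blinfun_compose)
    then show "convex {R. R o\<^sub>L Blinfun (\<rho> h) \<in> averages}"
      using convex_linear_vimage[OF _ averages_convex] by (simp add: vimage_def)
    show "Blinfun (\<rho> g) o\<^sub>L Blinfun (\<rho> h) \<in> averages" for g
    proof -
      have "Blinfun (\<rho> g) o\<^sub>L Blinfun (\<rho> h) = Blinfun (\<rho> (g + h))"
        by (rule blinfun_eqI) (simp add: action_plus)
      then show ?thesis by (simp add: action_in_averages)
    qed
  qed
  show ?thesis
    using Q
  proof (rule averages_induct)
    have "linear (\<lambda>Q. R o\<^sub>L Q)"
      by (intro bounded_linear.linear bounded_bilinear.bounded_linear_right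
          bounded_bilinear_blinfun_compose)
    then show "convex {Q. R o\<^sub>L Q \<in> averages}"
      using convex_linear_vimage[OF _ averages_convex] by (simp add: vimage_def)
  qed (rule left[OF R])
qed

lemma averages_commute:
  assumes "R \<in> averages" and B: "bounded_linear B" and comm: "\<And>g v. \<rho> g (B v) = B (\<rho> g v)"
  shows "R (B v) = B (R v)"
  using assms(1)
proof (rule averages_induct)
  interpret bounded_linear B by fact
  show "convex {R. blinfun_apply R (B v) = B (blinfun_apply R v)}"
    by (rule convexI) (simp add: blinfun.bilinear_simps add scaleR)
qed (simp add: comm)

lemmas averages_closure_bound = sot_closure_bound[OF _ averages_bound]

lemma averages_closure_commute:
  assumes "T \<in> sot_closure averages" "bounded_linear B" "\<And>g v. \<rho> g (B v) = B (\<rho> g v)"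
  shows "T (B v) = B (T v)"
  using sot_closure_commute[OF assms(1,2)] averages_commute[OF _ assms(2,3)] by blast

lemma averages_closure_compose:
  "T \<in> sot_closure averages \<Longrightarrow> U \<in> sot_closure averages \<Longrightarrow> T o\<^sub>L U \<in> sot_closure averages"
  by (rule sot_closure_compose[where C = C]) (use averages_bound averages_compose C_ge_1 in auto)

section \<open>The averaging operator of the measure\<close>

definition M :: "'v \<Rightarrow> 'v"
  where "M = mu_operator sc \<mu> \<rho>"

lemma functional_eqI:
  assumes "\<And>\<phi> :: 'v \<Rightarrow> real. bounded_linear \<phi> \<Longrightarrow> \<phi> x = \<phi> y"
  shows "x = y"
proof (rule ccontr)
  assume "x \<noteq> y"
  then obtain f :: "'v \<Rightarrow> real" where "bounded_linear f" "f (x - y) > 0"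
    using separating_functional[of "{0}" "x - y"] by auto
  then show False
    using assms[of f] by (simp add: bounded_linear.linear linear_diff)
qed

text \<open>The integral of a non-integrable function is 0 by convention, so the linearity of
  \<open>M\<close> rests on this. Orbit functions are bounded, and continuity makes them Baire
  measurable.\<close>

lemma dual_orbit_integrable:
  assumes "\<Phi> \<in> continuous_dual sc"
  shows "integrable \<mu> (\<lambda>g. \<Phi> (\<rho> g v))"
proof -
  have \<Phi>: "bounded_linear \<Phi>" using assms by (simp add: continuous_dual_def)
  obtain c where c: "c > 0" "\<And>x. norm (\<Phi> x) \<le> norm x * c"
    using bounded_linear.pos_bounded[OF \<Phi>] by blast
  interpret prob_space \<mu> using baire by (simp add: baire_prob_def)
  show ?thesis
  proof (rule integrable_const_bound)
    have "norm (\<Phi> (\<rho> g v)) \<le> C * norm v * c" for g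
      using c(2)[of "\<rho> g v"] mult_right_mono[OF bound[of g v], of c] c(1) by linarith
    then show "AE g in \<mu>. norm (\<Phi> (\<rho> g v)) \<le> C * norm v * c" by simp
    have "continuous_on UNIV (\<lambda>g. \<Phi> (\<rho> g v))"
      by (rule bounded_linear.continuous_on[OF \<Phi>]) (use cont in \<open>simp add: strongly_continuous_def\<close>)
    then show "(\<lambda>g. \<Phi> (\<rho> g v)) \<in> borel_measurable \<mu>"
      using baire by (intro baire_measurable_continuous) (auto simp: baire_prob_def)
  qed
qed

lemma M_weak_average: "weak_average sc \<mu> \<rho> v (M v)"
proof -
  have ex: "\<exists>w. weak_average sc \<mu> \<rho> v w"
    using stationary by (simp add: weakly_uniquely_stationary_def mu_integrable_def)
  have "w = w'" if w: "weak_average sc \<mu> \<rho> v w" "weak_average sc \<mu> \<rho> v w'" for w w'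
  proof (rule functional_eqI)
    fix \<phi> :: "'v \<Rightarrow> real" assume "bounded_linear \<phi>"
    then obtain \<Phi> where \<Phi>: "\<Phi> \<in> continuous_dual sc" "\<And>a v. inner (a * \<Phi> v) 1 = \<phi> (sc a v)"
      using scalar_functional[OF banach_space_axioms] by blast
    then have "\<Phi> w = \<Phi> w'" using w unfolding weak_average_def by metis
    then show "\<phi> w = \<phi> w'" using \<Phi>(2)[of 1 w] \<Phi>(2)[of 1 w'] by simp
  qed
  then have "\<exists>!w. weak_average sc \<mu> \<rho> v w" using ex by blast
  then show ?thesis unfolding M_def mu_operator_def by (rule theI')
qed

lemma M_functional:
  assumes "bounded_linear (\<phi> :: 'v \<Rightarrow> real)"
  shows "integrable \<mu> (\<lambda>g. \<phi> (\<rho> g v))" and "\<phi> (M v) = (\<integral>g. \<phi> (\<rho> g v) \<partial>\<mu>)"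
proof -
  obtain \<Phi> where \<Phi>: "\<Phi> \<in> continuous_dual sc" "\<And>a v. inner (a * \<Phi> v) 1 = \<phi> (sc a v)"
    using scalar_functional[OF banach_space_axioms assms] by blast
  have \<phi>: "\<phi> = (\<lambda>v. \<Phi> v \<bullet> 1)" using \<Phi>(2)[of 1] by auto
  note int = dual_orbit_integrable[OF \<Phi>(1), of v]
  show "integrable \<mu> (\<lambda>g. \<phi> (\<rho> g v))" unfolding \<phi> by (intro integrable_inner_left int)
  show "\<phi> (M v) = (\<integral>g. \<phi> (\<rho> g v) \<partial>\<mu>)"
    using M_weak_average[of v] \<Phi>(1) int unfolding \<phi> by (simp add: weak_average_def)
qed

lemma M_scale: "M (sc a v) = sc a (M v)"
proof (rule functional_eqI)
  fix \<phi> :: "'v \<Rightarrow> real" assume \<phi>: "bounded_linear \<phi>"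
  have "bounded_linear (\<lambda>v. \<phi> (sc a v))" by (rule bounded_linear_compose[OF \<phi> bounded_linear_scale])
  from M_functional(2)[OF this, of v] M_functional(2)[OF \<phi>, of "sc a v"]
  show "\<phi> (M (sc a v)) = \<phi> (sc a (M v))" by (simp add: action_scale)
qed

lemma bounded_linear_M: "bounded_linear M"
proof (rule bounded_linear_intro[of _ C])
  fix v w
  show "M (v + w) = M v + M w"
  proof (rule functional_eqI)
    fix \<phi> :: "'v \<Rightarrow> real" assume \<phi>: "bounded_linear \<phi>"
    then interpret \<phi>: bounded_linear \<phi> .
    show "\<phi> (M (v + w)) = \<phi> (M v + M w)"
      using M_functional[OF \<phi>]
      by (simp add: \<phi>.add linear_add[OF bounded_linear.linear[OF bounded_linear_action]])
  qed
next
  fix r v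
  show "M (r *\<^sub>R v) = r *\<^sub>R M v" using M_scale[of "of_real r" v] by (simp add: scale_of_real)
next
  fix v
  \<comment> \<open>Separating the singleton of \<open>M v\<close> from 0 at distance
    \<open>norm (M v)\<close> yields a norming functional.\<close>
  obtain f :: "'v \<Rightarrow> real" where f: "bounded_linear f" "\<And>x. f x \<le> norm x" "norm (M v) \<le> f (M v)"
    using convex_separation[of "{M v}" "norm (M v)"] by auto
  interpret prob_space \<mu> using baire by (simp add: baire_prob_def)
  have "f (M v) \<le> (\<integral>g. C * norm v \<partial>\<mu>)"
    unfolding M_functional(2)[OF f(1)]
    by (rule integral_mono[OF M_functional(1)[OF f(1)]])
      (use f(2) bound order_trans in \<open>auto intro: order_trans\<close>)
  then show "norm (M v) \<le> norm v * C" using f(3) by (simp add: prob_space mult.commute)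
qed

definition Mb :: "'v \<Rightarrow>\<^sub>L 'v"
  where "Mb = Blinfun M"

lemma apply_Mb [simp]: "blinfun_apply Mb = M"
  unfolding Mb_def by (rule bounded_linear_Blinfun_apply[OF bounded_linear_M])

text \<open>Convexity turns weak information into strong. If the tuple of all \<open>M (x i)\<close>
  stayed away from the convex set of tuples \<open>R (x i)\<close>, a functional would separate them
  by \<delta>, uniformly over all \<open>R = \<rho> g\<close>. Integrating this over the probability
  measure compares the tuple of all \<open>M (x i)\<close> with itself, a contradiction.\<close>

lemma Mb_in_closure: "Mb \<in> sot_closure averages"
proof -
  have "\<exists>R\<in>averages. \<forall>v\<in>F. norm (blinfun_apply R v - Mb v) < \<delta>" if F: "finite F" "\<delta> > 0" for F \<delta>
  proof (rule ccontr)
    assume neg: "\<not> ?thesis"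
    obtain n and x :: "nat \<Rightarrow> 'v" where x: "F = x ` {i. i < n}"
      using finite_imp_nat_seg_image_inj_on[OF F(1)] by blast
    define L where "L = (\<lambda>T :: 'v \<Rightarrow>\<^sub>L 'v. \<Sum>i<n. at_index i (T (x i)))"
    have "linear L"
      by (rule linearI) (simp_all add: L_def blinfun.bilinear_simps sum.distrib scaleR_sum_right
          linear_add linear_scale bounded_linear.linear[OF bounded_linear_at_index])
    define D where "D = L ` (\<Union>T\<in>{Mb}. \<Union>R\<in>averages. {T - R})"
    have conv: "convex D" unfolding D_def
      by (intro convex_linear_image[OF \<open>linear L\<close>] convex_differences averages_convex convex_singleton)
    have low: "\<delta> \<le> norm y" if y: "y \<in> D" for y
    proof -
      obtain R where R: "R \<in> averages" "y = L (Mb - R)" using y by (auto simp: D_def)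
      then obtain i where i: "i < n" "\<delta> \<le> norm (R (x i) - Mb (x i))"
        using neg x by (force simp: not_less)
      have "apply_bcontfun y i = Mb (x i) - R (x i)"
        using i(1) by (simp add: R L_def apply_bcontfun_sum blinfun.bilinear_simps sum.delta)
      then show ?thesis
        using i(2) norm_bounded[of y i] by (simp add: norm_minus_commute)
    qed
    obtain f where f: "bounded_linear f" "\<And>y. y \<in> D \<Longrightarrow> \<delta> \<le> f y"
      using convex_separation[OF conv low] by blast
    define \<phi> where "\<phi> = (\<lambda>i v. f (at_index i v))"
    have \<phi>: "bounded_linear (\<phi> i)" for i
      unfolding \<phi>_def by (rule bounded_linear_compose[OF f(1) bounded_linear_at_index])
    have fL: "f (L T) = (\<Sum>i<n. \<phi> i (T (x i)))" for T
      unfolding L_def \<phi>_def by (rule linear_sum[OF bounded_linear.linear[OF f(1)]])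
    have sep: "(\<Sum>i<n. \<phi> i (\<rho> g (x i))) \<le> (\<Sum>i<n. \<phi> i (M (x i))) - \<delta>" for g
    proof -
      have "L (Mb - Blinfun (\<rho> g)) \<in> D" using action_in_averages by (auto simp: D_def)
      then have "\<delta> \<le> f (L Mb) - f (L (Blinfun (\<rho> g)))"
        using f(2) \<open>linear L\<close> by (force simp: linear_diff bounded_linear.linear[OF f(1)])
      then show ?thesis by (simp add: fL)
    qed
    interpret prob_space \<mu> using baire by (simp add: baire_prob_def)
    have "(\<Sum>i<n. \<phi> i (M (x i))) = (\<integral>g. (\<Sum>i<n. \<phi> i (\<rho> g (x i))) \<partial>\<mu>)"
      using M_functional[OF \<phi>] by simp
    also have "\<dots> \<le> (\<integral>g. (\<Sum>i<n. \<phi> i (M (x i))) - \<delta> \<partial>\<mu>)"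
      using M_functional(1)[OF \<phi>] sep by (intro integral_mono) auto
    also have "\<dots> = (\<Sum>i<n. \<phi> i (M (x i))) - \<delta>" by (simp add: prob_space)
    finally show False using F(2) by simp
  qed
  then show ?thesis by (simp add: sot_closure_def)
qed

section \<open>Stationary vectors and density of the ergodic subspace\<close>

definition fixed :: "'v set"
  where "fixed = {v. M v = v}"

lemma fixed_eq: "stationary_vectors sc \<mu> \<rho> = fixed"
  by (simp add: stationary_vectors_def fixed_def M_def)

lemma M_linear_simps: "M (x + y) = M x + M y" "M (x - y) = M x - M y" "M (r *\<^sub>R x) = r *\<^sub>R M x" "M 0 = 0"
  using bounded_linear.linear[OF bounded_linear_M]
  by (simp_all add: linear_add linear_diff linear_scale linear_0)

lemma fixed_subspace: "real_vector.subspace fixed"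
  by (rule real_vector.subspaceI) (simp_all add: fixed_def M_linear_simps)

lemma fixed_scale: "v \<in> fixed \<Longrightarrow> sc a v \<in> fixed"
  by (simp add: fixed_def M_scale)

lemma fixed_scalar_subspace: "subspace fixed"
  by (rule subspaceI) (simp_all add: fixed_def M_linear_simps M_scale)

text \<open>Weak unique stationarity is the assertion that this subspace has no nonzero annihilator.\<close>

definition ergodic_subspace :: "'v set"
  where "ergodic_subspace = {u + (M w - w) | u w. u \<in> fixed}"

text \<open>A functional vanishing on every \<open>M w - w\<close> is invariant under
  \<open>M\<close>. If it is nonzero, weak unique stationarity supplies a stationary vector on which
  it does not vanish, although it annihilates the stationary vectors too.\<close>

lemma ergodic_subspace_dense: "closure ergodic_subspace = UNIV"
proof (rule ccontr)
  assume "closure ergodic_subspace \<noteq> UNIV"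
  then obtain x where x: "x \<notin> closure ergodic_subspace" by blast
  have mem: "u + (M w - w) \<in> ergodic_subspace" if "u \<in> fixed" for u w
    using that by (auto simp: ergodic_subspace_def)
  have "real_vector.subspace ergodic_subspace"
  proof (rule real_vector.subspaceI)
    show "0 \<in> ergodic_subspace"
      using mem[OF real_vector.subspace_0[OF fixed_subspace], of 0] by (simp add: M_linear_simps)
  next
    fix x y assume "x \<in> ergodic_subspace" "y \<in> ergodic_subspace"
    then obtain u w u' w' where *: "x = u + (M w - w)" "y = u' + (M w' - w')" "u \<in> fixed" "u' \<in> fixed"
      by (auto simp: ergodic_subspace_def)
    have "x + y = (u + u') + (M (w + w') - (w + w'))" by (simp add: * M_linear_simps)
    then show "x + y \<in> ergodic_subspace" using mem real_vector.subspace_add[OF fixed_subspace *(3,4)] by metis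
  next
    fix r :: real and x assume "x \<in> ergodic_subspace"
    then obtain u w where *: "x = u + (M w - w)" "u \<in> fixed"
      by (auto simp: ergodic_subspace_def)
    have "r *\<^sub>R x = r *\<^sub>R u + (M (r *\<^sub>R w) - r *\<^sub>R w)"
      by (simp add: * M_linear_simps scaleR_add_right scaleR_diff_right)
    then show "r *\<^sub>R x \<in> ergodic_subspace" using mem real_vector.subspace_scale[OF fixed_subspace *(2)] by metis
  qed
  then obtain f :: "'v \<Rightarrow> real" where f: "bounded_linear f" "\<And>w. w \<in> ergodic_subspace \<Longrightarrow> f w = 0" "f x > 0"
    using separating_functional[OF _ x] by blast
  obtain \<Phi> where \<Phi>: "\<Phi> \<in> continuous_dual sc" "\<And>a v. inner (a * \<Phi> v) 1 = f (sc a v)"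
    using scalar_functional[OF banach_space_axioms f(1)] by blast
  have \<Phi>_lin: "linear \<Phi>" using \<Phi>(1) by (simp add: continuous_dual_def bounded_linear.linear)
  have sc_mem: "sc a w \<in> ergodic_subspace" if w: "w \<in> ergodic_subspace" for a w
  proof -
    obtain u y where *: "w = u + (M y - y)" "u \<in> fixed" using w by (auto simp: ergodic_subspace_def)
    have "sc a w = sc a u + (M (sc a y) - sc a y)"
      by (simp add: * M_scale scale_right_distrib scale_right_diff_distrib)
    then show ?thesis using mem fixed_scale *(2) by metis
  qed
  \<comment> \<open>Separation gives a real functional, whereas stationarity concerns scalar-linear
    ones. Stability of the subspace under scalars transfers the vanishing from \<open>f\<close> to
    \<Phi>.\<close>
  have zero: "\<Phi> w = 0" if w: "w \<in> ergodic_subspace" for w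
  proof (rule ccontr)
    assume "\<Phi> w \<noteq> 0"
    then have "inverse (\<Phi> w) * \<Phi> w = 1" by simp
    moreover have "inner (inverse (\<Phi> w) * \<Phi> w) 1 = 0" using \<Phi>(2) f(2) sc_mem[OF w] by simp
    ultimately have "inner (1 :: 'k) 1 = 0" by simp
    then show False by (simp only: inner_eq_zero_iff one_neq_zero)
  qed
  have "\<Phi> (M w) = \<Phi> w" for w
  proof -
    have "0 + (M w - w) \<in> ergodic_subspace" by (rule mem) (rule real_vector.subspace_0[OF fixed_subspace])
    then show ?thesis using zero[of "M w - w"] by (simp add: linear_diff[OF \<Phi>_lin])
  qed
  then have "\<Phi> \<circ> mu_operator sc \<mu> \<rho> = \<Phi>" by (auto simp: M_def)
  moreover have "\<Phi> \<noteq> (\<lambda>_. 0)" using \<Phi>(2)[of 1 x] f(3) by auto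
  ultimately obtain v where v: "v \<in> fixed" "\<Phi> v \<noteq> 0"
    using stationary \<Phi>(1) unfolding weakly_uniquely_stationary_def fixed_eq by blast
  have "v + (M 0 - 0) \<in> ergodic_subspace" by (rule mem[OF v(1)])
  then show False using zero v(2) by (simp add: M_linear_simps)
qed

section \<open>Cesaro means and the mean ergodic projection\<close>

primrec power_Mb :: "nat \<Rightarrow> 'v \<Rightarrow>\<^sub>L 'v"
  where "power_Mb 0 = id_blinfun" | "power_Mb (Suc n) = Mb o\<^sub>L power_Mb n"

text \<open>The weights stand inside the sum, which makes it literally a convex combination of the
  \<open>n + 1\<close> powers.\<close>

definition cesaro :: "nat \<Rightarrow> 'v \<Rightarrow>\<^sub>L 'v"
  where "cesaro n = (\<Sum>k\<le>n. (1 / real (Suc n)) *\<^sub>R power_Mb k)"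

text \<open>This is the source of power boundedness: elements of the closure obey the bound
  \<open>C\<close>, and the closure is stable under composition.\<close>

lemma power_Mb_in_closure: "power_Mb n \<in> sot_closure averages"
proof (induction n)
  case 0
  have eq: "power_Mb 0 = Blinfun (\<rho> 0)" by (rule blinfun_eqI) (simp add: action_zero)
  show ?case unfolding eq by (rule subsetD[OF sot_closure_superset action_in_averages])
next
  case (Suc n)
  then show ?case using averages_closure_compose[OF Mb_in_closure] by simp
qed

lemma power_Mb_commute: "power_Mb n (M v) = M (power_Mb n v)"
  by (induction n) auto

lemma cesaro_in_closure: "cesaro n \<in> sot_closure averages"
  unfolding cesaro_def
  by (rule convex_sum[OF _ sot_closure_convex[OF averages_convex]])
    (auto simp: power_Mb_in_closure)

lemma cesaro_apply: "cesaro n v = (1 / real (Suc n)) *\<^sub>R (\<Sum>k\<le>n. power_Mb k v)"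
  by (simp add: cesaro_def blinfun.sum_left blinfun.scaleR_left scaleR_sum_right)

text \<open>The sum telescopes to \<open>power_Mb (Suc n) w - w\<close>, which stays bounded while
  the weight tends to 0.\<close>

lemma cesaro_coboundary_tendsto: "(\<lambda>n. cesaro n (M w - w)) \<longlonglongrightarrow> 0"
proof -
  have "(\<Sum>k\<le>n. power_Mb k (M w - w)) = power_Mb (Suc n) w - w" for n
    by (induction n) (simp_all add: blinfun.diff_right power_Mb_commute)
  then have eq: "cesaro n (M w - w) = inverse (real (Suc n)) *\<^sub>R (power_Mb (Suc n) w - w)" for n
    by (simp only: cesaro_apply inverse_eq_divide)
  have "norm (power_Mb (Suc n) w - w) \<le> C * norm w + norm w" for n
    using averages_closure_bound[OF power_Mb_in_closure, of "Suc n" w]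
      norm_triangle_ineq4[of "power_Mb (Suc n) w" w] by linarith
  then have bnd: "norm (cesaro n (M w - w)) \<le> inverse (real (Suc n)) * (C * norm w + norm w)" for n
    unfolding eq by (simp add: mult_left_mono del: of_nat_Suc)
  have "(\<lambda>n. inverse (real (Suc n)) * (C * norm w + norm w)) \<longlonglongrightarrow> 0"
    by (rule tendsto_mult_left_zero[OF LIMSEQ_inverse_real_of_nat])
  then show ?thesis
    by (rule Lim_null_comparison[rotated]) (intro always_eventually allI bnd)
qed

lemma cesaro_fixed: "v \<in> fixed \<Longrightarrow> cesaro n v = v"
proof -
  assume v: "v \<in> fixed"
  have "power_Mb k v = v" for k
    using v by (induction k) (auto simp: fixed_def)
  then show ?thesis by (simp add: cesaro_apply sum_constant_scaleR del: of_nat_Suc)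
qed

text \<open>Convergence on a dense subspace extends to all vectors because the Cesaro means are
  equicontinuous.\<close>

lemma cesaro_convergent: "convergent (\<lambda>n. cesaro n v)"
proof -
  have "Cauchy (\<lambda>n. cesaro n v)"
  proof (rule metric_CauchyI)
    fix e :: real assume e: "e > 0"
    have "v \<in> closure ergodic_subspace" by (simp add: ergodic_subspace_dense)
    \<comment> \<open>After multiplication by \<open>C\<close> the approximation costs
      \<open>e / 4\<close> for each of the two means; the tails of the convergent sequence use the
      other two quarters.\<close>
    moreover have "e / (4 * C) > 0" using e C_ge_1 by simp
    ultimately obtain x where x: "x \<in> ergodic_subspace" "dist x v < e / (4 * C)"
      unfolding closure_approachable by blast
    have near: "dist (cesaro n v) (cesaro n x) < e / 4" for n
    proof -
      have "dist (cesaro n v) (cesaro n x) = norm (cesaro n (v - x))"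
        by (simp add: dist_norm blinfun.diff_right)
      also have "\<dots> \<le> C * norm (v - x)" by (rule averages_closure_bound[OF cesaro_in_closure])
      also have "\<dots> < C * (e / (4 * C))"
        using x(2) C_ge_1 by (intro mult_strict_left_mono) (auto simp: dist_norm norm_minus_commute)
      finally show ?thesis using C_ge_1 by simp
    qed
    obtain u w where uw: "x = u + (M w - w)" "u \<in> fixed" using x(1) by (auto simp: ergodic_subspace_def)
    have "(\<lambda>n. u + cesaro n (M w - w)) \<longlonglongrightarrow> u + 0"
      by (intro tendsto_intros cesaro_coboundary_tendsto)
    then have "(\<lambda>n. cesaro n x) \<longlonglongrightarrow> u"
      by (simp add: uw cesaro_fixed blinfun.add_right)
    then obtain N where N: "\<And>n. n \<ge> N \<Longrightarrow> dist (cesaro n x) u < e / 4"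
      using metric_LIMSEQ_D[of _ u "e / 4"] e by auto
    have "dist (cesaro m v) (cesaro n v) < e" if "m \<ge> N" "n \<ge> N" for m n
      using near[of m] near[of n] N[OF that(1)] N[OF that(2)] by metric
    then show "\<exists>N. \<forall>m\<ge>N. \<forall>n\<ge>N. dist (cesaro m v) (cesaro n v) < e" by blast
  qed
  then show ?thesis by (rule Cauchy_convergent)
qed

definition P :: "'v \<Rightarrow>\<^sub>L 'v"
  where "P = Blinfun (\<lambda>v. lim (\<lambda>n. cesaro n v))"

lemma cesaro_tendsto: "(\<lambda>n. cesaro n v) \<longlonglongrightarrow> P v"
proof -
  define L where "L = (\<lambda>v. lim (\<lambda>n. cesaro n v))"
  have L: "(\<lambda>n. cesaro n v) \<longlonglongrightarrow> L v" for v
    using cesaro_convergent unfolding L_def by (simp add: convergent_LIMSEQ_iff)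
  have "bounded_linear L"
  proof (rule bounded_linear_intro[of _ C])
    fix x y
    have "(\<lambda>n. cesaro n (x + y)) \<longlonglongrightarrow> L x + L y"
      unfolding blinfun.add_right by (intro tendsto_intros L)
    then show "L (x + y) = L x + L y" using L LIMSEQ_unique by blast
  next
    fix r :: real and x
    have "(\<lambda>n. cesaro n (r *\<^sub>R x)) \<longlonglongrightarrow> r *\<^sub>R L x"
      unfolding blinfun.scaleR_right by (intro tendsto_intros L)
    then show "L (r *\<^sub>R x) = r *\<^sub>R L x" using L LIMSEQ_unique by blast
  next
    fix x
    have "norm (L x) \<le> C * norm x"
      by (rule Lim_bounded[OF tendsto_norm[OF L], of 0])
        (simp add: averages_closure_bound[OF cesaro_in_closure])
    then show "norm (L x) \<le> norm x * C" by (simp add: mult.commute)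
  qed
  then have "blinfun_apply P = L" unfolding P_def L_def by (rule bounded_linear_Blinfun_apply)
  then show ?thesis using L by simp
qed

lemma P_in_closure: "P \<in> sot_closure averages"
  by (rule sot_closure_limit[OF cesaro_in_closure cesaro_tendsto])

lemma P_fixed: "v \<in> fixed \<Longrightarrow> P v = v"
  using cesaro_tendsto[of v] by (simp add: cesaro_fixed LIMSEQ_const_iff)

text \<open>The Cesaro means commute with \<open>M\<close>, so their defect of invariance at
  \<open>v\<close> is their value at the coboundary \<open>M v - v\<close>, which tends to
  0.\<close>

lemma P_range: "P v \<in> fixed"
proof -
  have "(\<lambda>n. M (cesaro n v) - cesaro n v) \<longlonglongrightarrow> M (P v) - P v"
    by (rule tendsto_diff[OF bounded_linear.tendsto[OF bounded_linear_M cesaro_tendsto] cesaro_tendsto])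
  moreover have "M (cesaro n v) - cesaro n v = cesaro n (M v - v)" for n
  proof -
    have "M (cesaro n v) = cesaro n (M v)"
      by (simp add: cesaro_apply power_Mb_commute M_linear_simps
          linear_sum[OF bounded_linear.linear[OF bounded_linear_M]])
    then show ?thesis by (simp add: blinfun.diff_right)
  qed
  ultimately have "(\<lambda>n. cesaro n (M v - v)) \<longlonglongrightarrow> M (P v) - P v" by simp
  then have "M (P v) - P v = 0" using cesaro_coboundary_tendsto LIMSEQ_unique by blast
  then show ?thesis by (simp add: fixed_def)
qed

lemma P_scale: "P (sc a v) = sc a (P v)"
  by (rule averages_closure_commute[OF P_in_closure bounded_linear_scale action_scale])

lemma P_commute:
  assumes "bounded_linear B" "\<And>g v. \<rho> g (B v) = B (\<rho> g v)"
  shows "P (B v) = B (P v)"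
  by (rule averages_closure_commute[OF P_in_closure assms])

text \<open>Operators commuting with the action commute with \<open>P\<close>, hence preserve its
  range \<open>fixed\<close>. This makes the stationary vectors of one factor a module over the
  other factor.\<close>

lemma fixed_invariant:
  assumes "bounded_linear B" "\<And>g v. \<rho> g (B v) = B (\<rho> g v)" and "v \<in> fixed"
  shows "B v \<in> fixed"
  using P_commute[OF assms(1,2), of v] P_fixed[OF assms(3)] P_range[of "B v"] by simp

end

section \<open>The compact-open topology on cochains\<close>

lemma cochains_continuous:
  "f \<in> cochains n W \<Longrightarrow> continuous_map (power_topology n) euclidean f"
  unfolding cochains_def using continuous_map_into_fulltopology by blast

text \<open>One half of the identification with uniform convergence on compact sets.
  \<open>K\<close> is cut into finitely many compact pieces on which \<open>f\<close> is within
  \<open>e / 4\<close> of a constant; asking for \<open>e / 2\<close> there makes the total error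
  \<open>3 * e / 4\<close>.\<close>

lemma compact_open_neighbourhood:
  fixes f :: "(nat \<Rightarrow> 'g::topological_space) \<Rightarrow> 'v::banach"
  assumes f: "f \<in> cochains n W" and K: "compactin (power_topology n) K" and e: "e > 0"
  shows "\<exists>N. openin (compact_open_topology n W) N \<and> f \<in> N \<and>
    (\<forall>h\<in>N. h \<in> cochains n W \<and> (\<forall>x\<in>K. norm (h x - f x) < e))"
proof -
  note cf = cochains_continuous[OF f]
  have "compact (f ` K)" using image_compactin[OF K cf] by simp
  then obtain F where F: "finite F" "F \<subseteq> f ` K" "f ` K \<subseteq> (\<Union>y\<in>F. ball y (e / 4))"
    using seq_compact_imp_totally_bounded compact_imp_seq_compact e by (metis zero_less_divide_iff zero_less_numeral)
  define L where "L = (\<lambda>y. {x \<in> topspace (power_topology n). f x \<in> cball y (e / 4)} \<inter> K)"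
  define A where "A = (\<lambda>K U. {h :: (nat \<Rightarrow> 'g) \<Rightarrow> 'v. h \<in> cochains n W \<and> h ` K \<subseteq> U})"
  \<comment> \<open>\<open>A {} UNIV\<close> is the set of all cochains; it keeps \<open>N\<close>
    inside the cochains when \<open>K\<close>, and hence \<open>F\<close>, is empty.\<close>
  define N where "N = \<Inter> (insert (A {} UNIV) ((\<lambda>y. A (L y) (ball y (e / 2))) ` F))"
  have A_open: "openin (compact_open_topology n W) (A K' U)"
    if "compactin (power_topology n) K'" "open U" for K' U
    unfolding compact_open_topology_def A_def
    by (rule topology_generated_by_Basis) (use that in blast)
  have L: "compactin (power_topology n) (L y)" for y
    unfolding L_def
    by (rule closed_Int_compactin[OF closedin_continuous_map_preimage[OF cf] K]) simp
  have "openin (compact_open_topology n W) N"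
    unfolding N_def by (rule openin_Inter) (auto intro!: A_open L simp: F(1))
  moreover have "f \<in> N"
    using f e by (auto simp: N_def A_def L_def)
  moreover have "h \<in> cochains n W \<and> (\<forall>x\<in>K. norm (h x - f x) < e)" if h: "h \<in> N" for h
  proof (intro conjI ballI)
    show "h \<in> cochains n W" using h by (auto simp: N_def A_def)
    fix x assume x: "x \<in> K"
    then obtain y where y: "y \<in> F" "dist y (f x) < e / 4" using F(3) by auto
    moreover have "x \<in> topspace (power_topology n)" using x compactin_subset_topspace[OF K] by blast
    ultimately have "x \<in> L y" using x by (simp add: L_def)
    moreover have "h \<in> A (L y) (ball y (e / 2))" using h y(1) by (auto simp: N_def)
    ultimately have "dist y (h x) < e / 2" by (auto simp: A_def)
    then have "dist (h x) (f x) < e"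
      using y(2) dist_triangle[of "h x" "f x" y] e by (simp add: dist_commute)
    then show "norm (h x - f x) < e" by (simp add: dist_norm)
  qed
  ultimately show ?thesis by blast
qed

text \<open>The other half, by induction on how the open set is generated. For a subbasic set, the
  compact image of \<open>K\<close> has a uniform margin inside \<open>U\<close>.\<close>

lemma compact_open_uniform:
  assumes "openin (compact_open_topology n W) S" "f \<in> S"
  shows "\<exists>K e. compactin (power_topology n) K \<and> e > 0 \<and>
    (\<forall>h\<in>cochains n W. (\<forall>x\<in>K. norm (h x - f x) < e) \<longrightarrow> h \<in> S)"
proof -
  have "generate_topology_on
      {{f \<in> cochains n W. f ` K \<subseteq> U} | K U. compactin (power_topology n) K \<and> open U} S"
    using assms(1) unfolding compact_open_topology_def by (rule openin_topology_generated_by)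
  then show ?thesis using assms(2)
  proof induction
    case (Int S T)
    then have "f \<in> S" "f \<in> T" by auto
    obtain K e where "compactin (power_topology n) K" "e > 0"
      "\<forall>h\<in>cochains n W. (\<forall>x\<in>K. norm (h x - f x) < e) \<longrightarrow> h \<in> S"
      using Int.IH(1)[OF \<open>f \<in> S\<close>] by blast
    moreover obtain K' e' where "compactin (power_topology n) K'" "e' > 0"
      "\<forall>h\<in>cochains n W. (\<forall>x\<in>K'. norm (h x - f x) < e') \<longrightarrow> h \<in> T"
      using Int.IH(2)[OF \<open>f \<in> T\<close>] by blast
    ultimately show ?case
      by (intro exI[of _ "K \<union> K'"] exI[of _ "min e e'"]) (auto intro: compactin_Un)
  next
    case (UN \<S>)
    then obtain S where S: "S \<in> \<S>" "f \<in> S" by blast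
    obtain K e where "compactin (power_topology n) K" "e > 0"
      "\<forall>h\<in>cochains n W. (\<forall>x\<in>K. norm (h x - f x) < e) \<longrightarrow> h \<in> S"
      using UN.IH[OF S] by blast
    then show ?case using S by blast
  next
    case (Basis S)
    then obtain K U where KU: "S = {f \<in> cochains n W. f ` K \<subseteq> U}"
      "compactin (power_topology n) K" "open U" by blast
    then have f: "f \<in> cochains n W" "f ` K \<subseteq> U" using Basis by auto
    show ?case
    proof -
      have "compact (f ` K)" using image_compactin[OF KU(2) cochains_continuous[OF f(1)]] by simp
      then obtain e where e: "e > 0" "\<And>y. y \<in> f ` K \<Longrightarrow> \<exists>G\<in>{U}. ball y e \<subseteq> G"
        by (rule Heine_Borel_lemma[of _ "{U}"]) (use KU(3) f(2) in auto)
      have "h ` K \<subseteq> U" if "\<forall>x\<in>K. norm (h x - f x) < e" for h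
        using e(2) that by (fastforce simp: dist_norm norm_minus_commute subset_iff)
      then show ?thesis using KU(1,2) e(1) by blast
    qed
  qed simp
qed

lemma topspace_compact_open: "topspace (compact_open_topology n W) = cochains n W"
proof -
  have "{h \<in> cochains n W. h ` {} \<subseteq> UNIV} \<in>
      {{f \<in> cochains n W. f ` K \<subseteq> U} | K U. compactin (power_topology n) K \<and> open U}"
    by (intro CollectI exI[of _ "{}"] exI[of _ UNIV]) simp
  then show ?thesis unfolding compact_open_topology_def topology_generated_by_topspace
    by (auto 0 3)
qed

section \<open>Embeddings of quotients\<close>

text \<open>\<open>Z\<close> meets every fibre of \<open>p\<close>, and on it \<open>\<Phi>\<close> is a homeomorphism onto its image.\<close>

lemma embedding_map_quotient:
  assumes p: "quotient_map X X' p" and q: "quotient_map Y Y' q" "open_map Y Y' q"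
    and \<Phi>: "continuous_map X Y \<Phi>"
    and T: "\<And>x. x \<in> topspace X \<Longrightarrow> T (p x) = q (\<Phi> x)"
    and Z: "Z \<subseteq> topspace X"
    and lift: "\<And>x. x \<in> topspace X \<Longrightarrow> \<exists>z\<in>Z. p z = p x \<and> \<Phi> z = \<Phi> x"
    and sat: "\<And>x y. x \<in> topspace X \<Longrightarrow> y \<in> topspace Y \<Longrightarrow> q y = q (\<Phi> x) \<Longrightarrow>
      \<exists>x'\<in>topspace X. p x' = p x \<and> \<Phi> x' = y"
    and inj: "inj_on \<Phi> Z"
    and nbhd: "\<And>S z. openin X S \<Longrightarrow> z \<in> Z \<Longrightarrow> z \<in> S \<Longrightarrow>
      \<exists>R. openin Y R \<and> \<Phi> z \<in> R \<and> (\<forall>z'\<in>Z. \<Phi> z' \<in> R \<longrightarrow> z' \<in> S)"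
  shows "embedding_map X' Y' T"
proof -
  have surj: "topspace X' = p ` topspace X" using quotient_imp_surjective_map[OF p] by simp
  have \<Phi>_top: "\<Phi> x \<in> topspace Y" if "x \<in> topspace X" for x
    using \<Phi> that by (auto simp: continuous_map_def)
  have "continuous_map X Y' (T \<circ> p)"
    by (rule continuous_map_eq[OF continuous_map_compose[OF \<Phi> quotient_imp_continuous_map[OF q(1)]]])
      (simp add: T)
  then have cont: "continuous_map X' Y' T" using continuous_compose_quotient_map[OF p] by blast
  have inj_T: "inj_on T (topspace X')"
  proof (rule inj_onI)
    fix u v assume "u \<in> topspace X'" "v \<in> topspace X'" and eq: "T u = T v"
    then obtain x y where xy: "x \<in> topspace X" "y \<in> topspace X" "u = p x" "v = p y"
      unfolding surj by blast
    have "q (\<Phi> x) = q (\<Phi> y)" using eq xy T by metis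
    \<comment> \<open>\<open>y\<close> is moved within its fibre until it has the same image under
      \<Phi> as \<open>x\<close>; after both are lifted to \<open>Z\<close>, injectivity identifies
      them.\<close>
    then obtain x' where x': "x' \<in> topspace X" "p x' = p y" "\<Phi> x' = \<Phi> x"
      using sat[OF xy(2) \<Phi>_top[OF xy(1)]] by blast
    obtain z z' where z: "z \<in> Z" "p z = p x" "\<Phi> z = \<Phi> x" "z' \<in> Z" "p z' = p x'" "\<Phi> z' = \<Phi> x'"
      using lift[OF xy(1)] lift[OF x'(1)] by blast
    then have "z = z'" using inj x'(3) by (metis inj_onD)
    then show "u = v" using z x' xy by metis
  qed
  have "open_map X' (subtopology Y' (T ` topspace X')) T"
    unfolding open_map_def
  proof (intro allI impI)
    fix U assume U: "openin X' U"
    define S where "S = {x \<in> topspace X. p x \<in> U}"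
    have S: "openin X S"
      unfolding S_def by (rule openin_continuous_map_preimage[OF quotient_imp_continuous_map[OF p] U])
    define R where "R = \<Union> {R. openin Y R \<and> (\<forall>z\<in>Z. \<Phi> z \<in> R \<longrightarrow> z \<in> S)}"
    have "openin Y R" unfolding R_def by (rule openin_Union) blast
    then have "openin Y' (q ` R)" using q(2) by (simp add: open_map_def)
    moreover have "T ` U = q ` R \<inter> T ` topspace X'"
    proof (intro equalityI subsetI)
      fix t assume "t \<in> T ` U"
      then obtain u where u: "u \<in> U" "t = T u" by blast
      then have "u \<in> topspace X'" using openin_subset[OF U] by blast
      then obtain x where x: "x \<in> topspace X" "u = p x" unfolding surj by blast
      obtain z where z: "z \<in> Z" "p z = p x" "\<Phi> z = \<Phi> x" using lift[OF x(1)] by blast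
      then have "z \<in> S" using u x Z by (auto simp: S_def)
      then have "\<Phi> z \<in> R" unfolding R_def using nbhd[OF S z(1)] by blast
      moreover have "t = q (\<Phi> z)" using u x z T by simp
      ultimately show "t \<in> q ` R \<inter> T ` topspace X'"
        using u \<open>u \<in> topspace X'\<close> by blast
    next
      fix t assume t: "t \<in> q ` R \<inter> T ` topspace X'"
      then obtain x where x: "x \<in> topspace X" "t = T (p x)" unfolding surj by blast
      obtain y R' where y: "t = q y" "y \<in> R'" "openin Y R'" "\<forall>z\<in>Z. \<Phi> z \<in> R' \<longrightarrow> z \<in> S"
        using t unfolding R_def by blast
      have "y \<in> topspace Y" using y openin_subset by blast
      moreover have "q y = q (\<Phi> x)" using x y T by simp
      ultimately obtain x' where x': "x' \<in> topspace X" "p x' = p x" "\<Phi> x' = y"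
        using sat[OF x(1)] by blast
      obtain z where "z \<in> Z" "p z = p x'" "\<Phi> z = \<Phi> x'" using lift[OF x'(1)] by blast
      then have "p x \<in> U" using y x' by (auto simp: S_def)
      then show "t \<in> T ` U" using x by blast
    qed
    ultimately show "openin (subtopology Y' (T ` topspace X')) (T ` U)"
      by (auto simp: openin_subtopology)
  qed
  then show ?thesis
    unfolding embedding_map_def using cont inj_T
    by (intro bijective_open_imp_homeomorphic_map)
      (auto simp: continuous_map_in_subtopology dest: continuous_map_image_subset_topspace)
qed

section \<open>First cohomology and crossed homomorphisms\<close>

definition arg_pair :: "'g \<Rightarrow> 'g \<Rightarrow> nat \<Rightarrow> 'g"
  where "arg_pair a c = (\<lambda>j\<in>{..<2}. if j = 0 then a else c)"

lemma topspace_power: "topspace (power_topology n) = extensional {..<n}"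
  by (auto simp: power_topology_def PiE_def)

lemma arg_pair_simps [simp]:
  "arg_pair a c 0 = a" "arg_pair a c 1 = c" "arg_pair a c (Suc 0) = c"
  "arg_pair a c \<in> extensional {..<2}"
  by (simp_all add: arg_pair_def)

lemma continuous_map_entry:
  "i < n \<Longrightarrow> continuous_map (power_topology n) euclidean (\<lambda>x. x i)"
  unfolding power_topology_def by (rule continuous_map_product_projection) simp

lemma continuous_map_arg_pair: "continuous_map euclidean (power_topology 2) (arg_pair a)"
  unfolding power_topology_def continuous_map_componentwise
  by (auto simp: less_2_cases_iff)

text \<open>The group topology enters through continuity of \<open>- g + h\<close> alone. Stated as
  an assumption, it lets the same locale serve the two factors and their product.\<close>

locale coefficient_module = banach_space sc
  for sc :: "'k::{real_normed_field, euclidean_space} \<Rightarrow> 'v::banach \<Rightarrow> 'v" +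
  fixes \<rho> :: "'g::{topological_space, group_add} \<Rightarrow> 'v \<Rightarrow> 'v" and W :: "'v set" and C :: real
  assumes diff_continuous: "continuous_on UNIV (\<lambda>p :: 'g \<times> 'g. - fst p + snd p)"
    and ub: "ub_module sc \<rho>"
    and cont: "strongly_continuous \<rho>"
    and C_ge_1: "C \<ge> 1"
    and bound: "norm (\<rho> g v) \<le> C * norm v"
    and W_subspace: "subspace W"
    and W_invariant: "w \<in> W \<Longrightarrow> \<rho> g w \<in> W"
begin

lemma bounded_linear_action: "bounded_linear (\<rho> g)"
  using ub by (simp add: ub_module_def bounded_operator_def)

lemma action_simps [simp]:
  "\<rho> (g + h) v = \<rho> g (\<rho> h v)" "\<rho> 0 v = v" "\<rho> g (sc a v) = sc a (\<rho> g v)"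
  "\<rho> g (v + w) = \<rho> g v + \<rho> g w" "\<rho> g (v - w) = \<rho> g v - \<rho> g w" "\<rho> g 0 = 0"
  using ub bounded_linear.linear[OF bounded_linear_action, of g]
  by (simp_all add: ub_module_def bounded_operator_def linear_add linear_diff linear_0)

lemma action_cancel [simp]: "\<rho> g (\<rho> (- g) v) = v"
  by (simp flip: action_simps(1))

text \<open>Uniform boundedness upgrades strong continuity to joint continuity, by splitting off the
  vector increment.\<close>

lemma action_continuous: "continuous_on UNIV (\<lambda>p. \<rho> (fst p) (snd p))"
  unfolding continuous_on_def
proof
  fix p :: "'g \<times> 'v"
  let ?F = "at p within UNIV"
  have "((\<lambda>q. \<rho> (fst q) (snd p)) \<longlongrightarrow> \<rho> (fst p) (snd p)) ?F"
    using cont unfolding strongly_continuous_def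
    by (intro continuous_on_tendsto_compose[of UNIV "\<lambda>g. \<rho> g (snd p)"] tendsto_intros) auto
  moreover have "((\<lambda>q. \<rho> (fst q) (snd q - snd p)) \<longlongrightarrow> 0) ?F"
  proof (rule Lim_null_comparison)
    show "\<forall>\<^sub>F q in ?F. norm (\<rho> (fst q) (snd q - snd p)) \<le> C * norm (snd q - snd p)"
      by (simp only: bound eventually_True)
    have "((\<lambda>q. C * norm (snd q - snd p)) \<longlongrightarrow> C * norm (snd p - snd p)) ?F"
      by (intro tendsto_intros)
    then show "((\<lambda>q. C * norm (snd q - snd p)) \<longlongrightarrow> 0) ?F" by simp
  qed
  ultimately have "((\<lambda>q. \<rho> (fst q) (snd p) + \<rho> (fst q) (snd q - snd p)) \<longlongrightarrow>
      \<rho> (fst p) (snd p) + 0) ?F" by (rule tendsto_add)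
  then show "((\<lambda>q. \<rho> (fst q) (snd q)) \<longlongrightarrow> \<rho> (fst p) (snd p)) ?F" by simp
qed

lemma continuous_map_pair_compose:
  fixes f :: "'a::topological_space \<times> 'b::topological_space \<Rightarrow> 'c::topological_space"
  assumes "continuous_on UNIV f" "continuous_map X euclidean a" "continuous_map X euclidean b"
  shows "continuous_map X euclidean (\<lambda>x. f (a x, b x))"
proof -
  have "continuous_map X (prod_topology euclidean euclidean) (\<lambda>x. (a x, b x))"
    by (subst continuous_map_pairwise) (simp add: o_def assms)
  then have "continuous_map X euclidean (f \<circ> (\<lambda>x. (a x, b x)))"
    using assms(1) by (intro continuous_map_compose) auto
  then show ?thesis by (simp add: o_def)
qed

section \<open>Homogeneous cocycles as crossed homomorphisms\<close>

definition crossed :: "('g \<Rightarrow> 'v) set"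
  where "crossed = {b. continuous_on UNIV b \<and> range b \<subseteq> W \<and> (\<forall>g h. b (g + h) = b g + \<rho> g (b h))}"

definition principal :: "'v \<Rightarrow> 'g \<Rightarrow> 'v"
  where "principal w = (\<lambda>g. \<rho> g w - w)"

text \<open>The inverse of restricting an invariant function of two arguments to the pairs
  \<open>(0, g)\<close>. Its value 0 off \<open>G^2\<close> matches the convention for
  cochains.\<close>

definition homogeneous :: "('g \<Rightarrow> 'v) \<Rightarrow> (nat \<Rightarrow> 'g) \<Rightarrow> 'v"
  where "homogeneous b x = (if x \<in> extensional {..<2} then \<rho> (x 0) (b (- x 0 + x 1)) else 0)"

lemma crossedD:
  assumes "b \<in> crossed"
  shows "continuous_on UNIV b" "b g \<in> W" "b (g + h) = b g + \<rho> g (b h)"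
  using assms by (auto simp: crossed_def)

lemma crossed_add: "b \<in> crossed \<Longrightarrow> c \<in> crossed \<Longrightarrow> (\<lambda>g. b g + c g) \<in> crossed"
  using subspace_add[OF W_subspace] by (auto simp: crossed_def image_subset_iff intro!: continuous_intros)

lemma crossed_diff: "b \<in> crossed \<Longrightarrow> c \<in> crossed \<Longrightarrow> (\<lambda>g. b g - c g) \<in> crossed"
  using subspace_diff[OF W_subspace] by (auto simp: crossed_def image_subset_iff intro!: continuous_intros)

lemma crossed_scale: "b \<in> crossed \<Longrightarrow> (\<lambda>g. sc a (b g)) \<in> crossed"
  using subspace_scale[OF W_subspace] bounded_linear.continuous_on[OF bounded_linear_scale]
  by (auto simp: crossed_def scale_right_distrib)

lemma principal_crossed: "w \<in> W \<Longrightarrow> principal w \<in> crossed"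
  using cont subspace_diff[OF W_subspace] W_invariant
  by (auto simp: crossed_def principal_def strongly_continuous_def intro!: continuous_intros)

lemma homogeneous_arg_pair [simp]: "homogeneous b (arg_pair 0 g) = b g"
  by (simp add: homogeneous_def)

lemma homogeneous_inject: "homogeneous b = homogeneous c \<longleftrightarrow> b = c"
  by (metis ext homogeneous_arg_pair)

lemma homogeneous_add: "homogeneous (\<lambda>g. b g + c g) x = homogeneous b x + homogeneous c x"
  and homogeneous_scale: "homogeneous (\<lambda>g. sc a (b g)) x = sc a (homogeneous b x)"
  by (simp_all add: homogeneous_def)

lemma inv_cochains_pair:
  assumes f: "f \<in> inv_cochains 2 W \<rho>"
  shows "f = homogeneous (\<lambda>g. f (arg_pair 0 g))"
proof
  fix x
  show "f x = homogeneous (\<lambda>g. f (arg_pair 0 g)) x"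
  proof (cases "x \<in> extensional {..<2}")
    case True
    have "(\<lambda>j\<in>{..<2}. x 0 + arg_pair 0 (- x 0 + x 1) j) = x"
      using True by (intro ext) (auto simp: arg_pair_def extensional_def restrict_def less_2_cases_iff)
    moreover have "f (\<lambda>j\<in>{..<2}. x 0 + arg_pair 0 (- x 0 + x 1) j) = \<rho> (x 0) (f (arg_pair 0 (- x 0 + x 1)))"
      using f by (simp add: inv_cochains_def topspace_power)
    ultimately show ?thesis using True by (simp add: homogeneous_def)
  next
    case False
    then show ?thesis using f
      by (simp add: inv_cochains_def cochains_def topspace_power homogeneous_def)
  qed
qed

lemma homogeneous_inv_cochain:
  assumes "continuous_on UNIV b" "range b \<subseteq> W"
  shows "homogeneous b \<in> inv_cochains 2 W \<rho>"
proof -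
  have "continuous_map (power_topology 2) euclidean (\<lambda>x. - x 0 + x 1 :: 'g)"
    using continuous_map_pair_compose[OF diff_continuous continuous_map_entry[of 0 2] continuous_map_entry[of 1 2]]
    by simp
  then have "continuous_map (power_topology 2) euclidean (b \<circ> (\<lambda>x. - x 0 + x 1))"
    by (rule continuous_map_compose) (simp add: assms(1))
  from continuous_map_pair_compose[OF action_continuous continuous_map_entry[of 0 2] this]
  have "continuous_map (power_topology 2) euclidean (\<lambda>x. \<rho> (x 0) (b (- x 0 + x 1)))"
    by simp
  then have "continuous_map (power_topology 2) euclidean (homogeneous b)"
    by (rule continuous_map_eq) (simp add: homogeneous_def topspace_power)
  moreover have "homogeneous b x \<in> W" for x
    using assms(2) W_invariant subspace_0[OF W_subspace] by (auto simp: homogeneous_def)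
  ultimately have "continuous_map (power_topology 2) (top_of_set W) (homogeneous b)"
    by (auto simp: continuous_map_in_subtopology)
  then have "homogeneous b \<in> cochains 2 W"
    by (simp add: cochains_def topspace_power homogeneous_def)
  moreover have "homogeneous b (\<lambda>j\<in>{..<2}. g + x j) = \<rho> g (homogeneous b x)"
    if "x \<in> extensional {..<2}" for g x
  proof -
    have "- (g + x 0) + (g + x 1) = - x 0 + (- g + (g + x 1))" by (simp only: minus_add add.assoc)
    then show ?thesis using that by (simp add: homogeneous_def)
  qed
  ultimately show ?thesis by (simp add: inv_cochains_def topspace_power)
qed

lemma coboundary_2:
  assumes "x \<in> extensional {..<3}"
  shows "coboundary 2 f x = f (arg_pair (x 1) (x 2)) - f (arg_pair (x 0) (x 2)) + f (arg_pair (x 0) (x 1))"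
proof -
  have "delete_entry 2 0 x = arg_pair (x 1) (x 2)" "delete_entry 2 1 x = arg_pair (x 0) (x 2)"
    "delete_entry 2 2 x = arg_pair (x 0) (x 1)"
    by (auto simp: delete_entry_def arg_pair_def less_Suc_eq numeral_2_eq_2 intro!: restrict_ext)
  then show ?thesis using assms
    by (simp add: coboundary_def topspace_power numeral_3_eq_3 numeral_2_eq_2)
qed

text \<open>The cocycle condition at the triple \<open>(0, g, g + h)\<close> is the crossed
  identity; applying \<open>\<rho> (x 0)\<close> to that identity recovers the condition at an
  arbitrary triple.\<close>

lemma cocycles_eq: "cocycles 1 W \<rho> = homogeneous ` crossed"
proof (intro equalityI subsetI)
  fix f assume "f \<in> cocycles 1 W \<rho>"
  then have f: "f \<in> inv_cochains 2 W \<rho>" "coboundary 2 f = (\<lambda>_. 0)"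
    unfolding cocycles_def Suc_1 by blast+
  define b where "b = (\<lambda>g. f (arg_pair 0 g))"
  have fb: "f = homogeneous b" unfolding b_def by (rule inv_cochains_pair[OF f(1)])
  have f_cont: "continuous_map (power_topology 2) (top_of_set W) f"
    using f(1) by (simp add: inv_cochains_def cochains_def)
  have "continuous_map euclidean (top_of_set W) b"
    unfolding b_def using continuous_map_compose[OF continuous_map_arg_pair f_cont] by (simp add: o_def)
  then have "continuous_on UNIV b" "range b \<subseteq> W"
    by (auto simp: continuous_map_in_subtopology)
  moreover have "b (g + h) = b g + \<rho> g (b h)" for g h
  proof -
    let ?x = "\<lambda>j\<in>{..<3::nat}. if j = 0 then 0 else if j = 1 then g else g + h"
    have "coboundary 2 f ?x = f (arg_pair g (g + h)) - f (arg_pair 0 (g + h)) + f (arg_pair 0 g)"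
      by (subst coboundary_2) auto
    then show ?thesis using f(2) by (simp add: fb homogeneous_def algebra_simps flip: add.assoc)
  qed
  ultimately have "b \<in> crossed" by (simp add: crossed_def)
  then show "f \<in> homogeneous ` crossed" using fb by blast
next
  fix f assume "f \<in> homogeneous ` crossed"
  then obtain b where b: "b \<in> crossed" "f = homogeneous b" by blast
  then have inv: "f \<in> inv_cochains 2 W \<rho>"
    by (auto intro!: homogeneous_inv_cochain simp: crossed_def)
  have "coboundary 2 f x = 0" for x
  proof (cases "x \<in> extensional {..<3}")
    case True
    have "b (- x 0 + x 2) = b (- x 0 + x 1) + \<rho> (- x 0 + x 1) (b (- x 1 + x 2))"
      using crossedD(3)[OF b(1), of "- x 0 + x 1" "- x 1 + x 2"] by (simp add: add.assoc)
    then have "\<rho> (x 0) (b (- x 0 + x 2)) = \<rho> (x 0) (b (- x 0 + x 1)) + \<rho> (x 1) (b (- x 1 + x 2))"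
      by simp
    then show ?thesis by (simp add: coboundary_2[OF True] b(2) homogeneous_def)
  next
    case False
    then show ?thesis by (simp add: coboundary_def topspace_power)
  qed
  then show "f \<in> cocycles 1 W \<rho>" using inv unfolding cocycles_def Suc_1 by blast
qed

text \<open>An invariant function of one argument is the orbit map of its value at 0, and the
  difference of two orbit points is a translate of \<open>\<rho> g w - w\<close>.\<close>

lemma coboundaries_eq: "coboundaries 1 W \<rho> = homogeneous ` principal ` W"
proof -
  define single where "single = (\<lambda>a. \<lambda>j\<in>{..<1::nat}. a :: 'g)"
  define orbit where "orbit = (\<lambda>w x. if x \<in> extensional {..<1::nat} then \<rho> (x 0) w else 0)"
  have orbit_cob: "coboundary 1 (orbit w) = homogeneous (principal w)" for w
  proof
    fix x :: "nat \<Rightarrow> 'g"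
    have "delete_entry 1 0 x = single (x 1)" "delete_entry 1 1 x = single (x 0)"
      by (auto simp: delete_entry_def single_def intro!: restrict_ext)
    then show "coboundary 1 (orbit w) x = homogeneous (principal w) x"
      by (simp add: coboundary_def topspace_power orbit_def single_def homogeneous_def
          principal_def numeral_2_eq_2 flip: action_simps(1) add.assoc)
  qed
  have "inv_cochains 1 W \<rho> = orbit ` W"
  proof (intro equalityI subsetI)
    fix f assume f: "f \<in> inv_cochains 1 W \<rho>"
    have single: "single 0 \<in> extensional {..<1}" by (simp add: single_def)
    then have "f (single 0) \<in> W"
      using f by (auto simp: inv_cochains_def cochains_def continuous_map_def topspace_power)
    moreover have "f = orbit (f (single 0))"
    proof
      fix x
      show "f x = orbit (f (single 0)) x"
      proof (cases "x \<in> extensional {..<1}")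
        case True
        then have "(\<lambda>j\<in>{..<1}. x 0 + single 0 j) = x"
          by (intro ext) (auto simp: single_def extensional_def restrict_def)
        moreover have "f (\<lambda>j\<in>{..<1}. x 0 + single 0 j) = \<rho> (x 0) (f (single 0))"
          using f single unfolding inv_cochains_def topspace_power by blast
        ultimately show ?thesis using True by (simp add: orbit_def)
      next
        case False
        then show ?thesis using f by (simp add: inv_cochains_def cochains_def topspace_power orbit_def)
      qed
    qed
    ultimately show "f \<in> orbit ` W" by blast
  next
    fix f assume "f \<in> orbit ` W"
    then obtain w where w: "w \<in> W" "f = orbit w" by blast
    have "continuous_map (power_topology 1) euclidean ((\<lambda>g. \<rho> g w) \<circ> (\<lambda>x. x 0))"
      by (rule continuous_map_compose[OF continuous_map_entry])
        (use cont in \<open>auto simp: strongly_continuous_def\<close>)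
    then have "continuous_map (power_topology 1) euclidean f"
      by (rule continuous_map_eq) (simp add: w orbit_def topspace_power)
    moreover have "f x \<in> W" for x
      using w W_invariant subspace_0[OF W_subspace] by (simp add: orbit_def)
    ultimately have "f \<in> cochains 1 W"
      by (auto simp: cochains_def continuous_map_in_subtopology topspace_power w orbit_def)
    then show "f \<in> inv_cochains 1 W \<rho>"
      by (simp add: inv_cochains_def topspace_power w orbit_def)
  qed
  then have "coboundaries 1 W \<rho> = coboundary 1 ` orbit ` W" unfolding coboundaries_def by (rule arg_cong)
  also have "\<dots> = homogeneous ` principal ` W" by (simp only: image_image orbit_cob)
  finally show ?thesis .
qed

end

text \<open>Otherwise the degree in \<open>cocycles 1 W \<rho>\<close> is rewritten and the lemmas on it no longer apply.\<close>

declare One_nat_def [simp del]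

context coefficient_module
begin

section \<open>The cocycle topology in terms of crossed homomorphisms\<close>

abbreviation cocycle_topology :: "((nat \<Rightarrow> 'g) \<Rightarrow> 'v) topology"
  where "cocycle_topology \<equiv> subtopology (compact_open_topology 2 W) (cocycles 1 W \<rho>)"

lemma homogeneous_cochain: "b \<in> crossed \<Longrightarrow> homogeneous b \<in> cochains 2 W"
  using homogeneous_inv_cochain[of b] by (auto simp: crossed_def inv_cochains_def)

lemma topspace_cocycle_topology: "topspace cocycle_topology = homogeneous ` crossed"
  using homogeneous_cochain by (auto simp: topspace_compact_open cocycles_eq)

text \<open>Closeness of homogeneous cocycles on a compact set of pairs follows from closeness of
  the crossed homomorphisms on its image under \<open>- x 0 + x 1\<close>; the factor
  \<open>C\<close> pays for the action of \<open>x 0\<close>.\<close>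

lemma open_cocyclesD:
  assumes "openin cocycle_topology S" "homogeneous b \<in> S" "b \<in> crossed"
  shows "\<exists>K e. compact K \<and> e > 0 \<and>
    (\<forall>c\<in>crossed. (\<forall>g\<in>K. norm (c g - b g) < e) \<longrightarrow> homogeneous c \<in> S)"
proof -
  obtain S' where S': "openin (compact_open_topology 2 W) S'" "S = S' \<inter> cocycles 1 W \<rho>"
    using assms(1) by (auto simp: openin_subtopology)
  then have "homogeneous b \<in> S'" using assms(2) by blast
  from compact_open_uniform[OF S'(1) this]
  obtain L e where L: "compactin (power_topology 2) L" "e > 0"
    "\<forall>h\<in>cochains 2 W. (\<forall>x\<in>L. norm (h x - homogeneous b x) < e) \<longrightarrow> h \<in> S'"
    by blast
  have "continuous_map (power_topology 2) euclidean (\<lambda>x. - x 0 + x 1 :: 'g)"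
    using continuous_map_pair_compose[OF diff_continuous continuous_map_entry[of 0 2] continuous_map_entry[of 1 2]]
    by simp
  from image_compactin[OF L(1) this] have "compact ((\<lambda>x. - x 0 + x 1) ` L)" by simp
  moreover have "e / C > 0" using L(2) C_ge_1 by simp
  moreover have "homogeneous c \<in> S"
    if c: "c \<in> crossed" and near: "\<forall>g\<in>(\<lambda>x. - x 0 + x 1) ` L. norm (c g - b g) < e / C" for c
  proof -
    have "norm (homogeneous c x - homogeneous b x) < e" if x: "x \<in> L" for x
    proof (cases "x \<in> extensional {..<2}")
      case True
      have "norm (c (- x 0 + x 1) - b (- x 0 + x 1)) < e / C" using near x by blast
      then have "C * norm (c (- x 0 + x 1) - b (- x 0 + x 1)) < e"
        using C_ge_1 by (simp add: field_simps)
      then show ?thesis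
        using bound[of "x 0" "c (- x 0 + x 1) - b (- x 0 + x 1)"] True
        by (simp add: homogeneous_def)
    qed (simp add: homogeneous_def L(2))
    then show ?thesis
      using bspec[OF L(3) homogeneous_cochain[OF c]] c by (simp add: S'(2) cocycles_eq)
  qed
  ultimately show ?thesis by blast
qed

lemma cocycle_neighbourhood:
  assumes b: "b \<in> crossed" and K: "compact K" and e: "e > 0"
  shows "\<exists>N. openin cocycle_topology N \<and> homogeneous b \<in> N \<and>
    (\<forall>c. homogeneous c \<in> N \<longrightarrow> (\<forall>g\<in>K. norm (c g - b g) < e))"
proof -
  have "compactin (power_topology 2) (arg_pair 0 ` K)"
    by (rule image_compactin[OF _ continuous_map_arg_pair]) (simp add: K)
  from compact_open_neighbourhood[OF homogeneous_cochain[OF b] this e]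
  obtain N where N: "openin (compact_open_topology 2 W) N" "homogeneous b \<in> N"
    "\<forall>h\<in>N. h \<in> cochains 2 W \<and> (\<forall>x\<in>arg_pair 0 ` K. norm (h x - homogeneous b x) < e)"
    by (elim exE conjE)
  have "norm (c g - b g) < e" if "homogeneous c \<in> N \<inter> cocycles 1 W \<rho>" "g \<in> K" for c g
    using bspec[OF N(3), of "homogeneous c"] that by auto
  moreover have "homogeneous b \<in> N \<inter> cocycles 1 W \<rho>" using N(2) b by (simp add: cocycles_eq)
  ultimately show ?thesis
    by (intro exI[of _ "N \<inter> cocycles 1 W \<rho>"] conjI openin_subtopology_Int[OF N(1)] allI impI ballI)
qed

lemma open_cocyclesI:
  assumes "S \<subseteq> homogeneous ` crossed"
    and "\<And>b. b \<in> crossed \<Longrightarrow> homogeneous b \<in> S \<Longrightarrow> \<exists>K e. compact K \<and> e > 0 \<and>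
      (\<forall>c\<in>crossed. (\<forall>g\<in>K. norm (c g - b g) < e) \<longrightarrow> homogeneous c \<in> S)"
  shows "openin cocycle_topology S"
proof (subst openin_subopen, intro ballI)
  fix f assume f: "f \<in> S"
  then obtain b where b: "b \<in> crossed" "f = homogeneous b" using assms(1) by blast
  from assms(2)[OF b(1)] f b(2) obtain K e where K: "compact K" "e > 0"
    "\<forall>c\<in>crossed. (\<forall>g\<in>K. norm (c g - b g) < e) \<longrightarrow> homogeneous c \<in> S"
    by blast
  obtain N where N: "openin cocycle_topology N" "f \<in> N"
    "\<forall>c. homogeneous c \<in> N \<longrightarrow> (\<forall>g\<in>K. norm (c g - b g) < e)"
    using cocycle_neighbourhood[OF b(1) K(1,2)] b(2) by blast
  have "N \<subseteq> homogeneous ` crossed"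
    using openin_subset[OF N(1)] unfolding topspace_cocycle_topology .
  then have "N \<subseteq> S" using N(3) K(3) by blast
  then show "\<exists>T. openin cocycle_topology T \<and> f \<in> T \<and> T \<subseteq> S" using N(1,2) by blast
qed

section \<open>Cosets and the linear and topological structure of first cohomology\<close>

abbreviation H1 :: "('k, ((nat \<Rightarrow> 'g) \<Rightarrow> 'v) set) tvs"
  where "H1 \<equiv> cohomology sc 1 W \<rho>"

definition coset :: "((nat \<Rightarrow> 'g) \<Rightarrow> 'v) \<Rightarrow> ((nat \<Rightarrow> 'g) \<Rightarrow> 'v) set"
  where "coset f = {\<lambda>x. f x + c x | c. c \<in> coboundaries 1 W \<rho>}"

lemma principal_add: "principal (v + w) g = principal v g + principal w g"
  and principal_diff: "principal (v - w) g = principal v g - principal w g"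
  and principal_scale: "principal (sc a w) g = sc a (principal w g)"
  and principal_zero: "principal 0 g = 0"
  by (simp_all add: principal_def scale_right_diff_distrib)

lemma coset_homogeneous:
  "coset (homogeneous b) = {homogeneous (\<lambda>g. b g + principal w g) | w. w \<in> W}"
proof -
  have "(\<lambda>x. homogeneous b x + homogeneous (principal w) x) = homogeneous (\<lambda>g. b g + principal w g)" for w
    by (simp add: homogeneous_add fun_eq_iff)
  moreover have "coset (homogeneous b) = {\<lambda>x. homogeneous b x + homogeneous (principal w) x | w. w \<in> W}"
    unfolding coset_def coboundaries_eq by auto
  ultimately show ?thesis by (simp only:)
qed

lemma coset_eq_iff:
  "coset (homogeneous b) = coset (homogeneous c) \<longleftrightarrow> (\<exists>w\<in>W. \<forall>g. b g = c g + principal w g)"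
proof
  assume eq: "coset (homogeneous b) = coset (homogeneous c)"
  have "homogeneous (\<lambda>g. b g + principal 0 g) \<in> coset (homogeneous b)"
    unfolding coset_homogeneous using subspace_0[OF W_subspace] by blast
  then have "homogeneous (\<lambda>g. b g + principal 0 g) \<in> coset (homogeneous c)"
    by (simp only: eq)
  then obtain w where "w \<in> W" "homogeneous (\<lambda>g. b g + principal 0 g) = homogeneous (\<lambda>g. c g + principal w g)"
    unfolding coset_homogeneous mem_Collect_eq by (elim exE conjE) (erule (1) that[rotated])
  then show "\<exists>w\<in>W. \<forall>g. b g = c g + principal w g"
    by (simp add: homogeneous_inject principal_zero) metis
next
  have sub: "coset (homogeneous b) \<subseteq> coset (homogeneous c)"
    if "w \<in> W" "\<And>g. b g = c g + principal w g" for b c w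
  proof
    fix f assume "f \<in> coset (homogeneous b)"
    then obtain v where v: "v \<in> W" "f = homogeneous (\<lambda>g. b g + principal v g)"
      unfolding coset_homogeneous by blast
    then have "f = homogeneous (\<lambda>g. c g + principal (w + v) g)"
      using that(2) by (simp add: principal_add add.assoc)
    then show "f \<in> coset (homogeneous c)"
      unfolding coset_homogeneous using subspace_add[OF W_subspace that(1) v(1)] by blast
  qed
  assume "\<exists>w\<in>W. \<forall>g. b g = c g + principal w g"
  then obtain w where w: "w \<in> W" "\<And>g. b g = c g + principal w g" by blast
  have "c g = b g + principal (- w) g" for g
    using principal_diff[of 0 w g] by (simp add: w(2) principal_zero)
  then show "coset (homogeneous b) = coset (homogeneous c)"
    using sub[OF w] sub[of "- w" c b] subspace_neg[OF W_subspace w(1)] by blast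
qed

lemma quotient_map_coset: "quotient_map cocycle_topology (tvs_top H1) coset"
proof -
  have "tvs_top H1 = quotient_topology cocycle_topology coset"
    unfolding cohomology_def coset_def Suc_1 by simp
  then show ?thesis by (simp add: quotient_map_quotient_topology)
qed

lemma carrier_H1: "tvs_carrier H1 = (\<lambda>b. coset (homogeneous b)) ` crossed"
  using quotient_imp_surjective_map[OF quotient_map_coset]
  unfolding topspace_cocycle_topology image_image by (rule sym)

text \<open>Absorbs the two independent coboundaries that arise when cosets are added or scaled,
  including scaling by 0.\<close>

lemma W_combinations: "{F (sc a v + w) | v w. v \<in> W \<and> w \<in> W} = {F u | u. u \<in> W}"
proof (intro equalityI subsetI)
  fix x assume "x \<in> {F u | u. u \<in> W}"
  then obtain u where u: "u \<in> W" "x = F u" by blast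
  then have "x = F (sc a 0 + u)" by simp
  then show "x \<in> {F (sc a v + w) | v w. v \<in> W \<and> w \<in> W}"
    using u(1) subspace_0[OF W_subspace] by blast
qed (use subspace_add[OF W_subspace] subspace_scale[OF W_subspace] in blast)

lemma H1_add: "tvs_add H1 (coset (homogeneous b)) (coset (homogeneous c)) =
  coset (homogeneous (\<lambda>g. b g + c g))"
proof -
  have sum: "(\<lambda>x. homogeneous (\<lambda>g. b g + principal v g) x + homogeneous (\<lambda>g. c g + principal w g) x) =
      homogeneous (\<lambda>g. (b g + c g) + principal (v + w) g)" for v w
    by (rule ext) (simp add: homogeneous_add principal_add algebra_simps)
  have "tvs_add H1 (coset (homogeneous b)) (coset (homogeneous c)) =
      {homogeneous (\<lambda>g. (b g + c g) + principal (v + w) g) | v w. v \<in> W \<and> w \<in> W}"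
    unfolding cohomology_def coset_homogeneous by (auto simp flip: sum)
  also have "\<dots> = coset (homogeneous (\<lambda>g. b g + c g))"
    using W_combinations[of "\<lambda>u. homogeneous (\<lambda>g. (b g + c g) + principal u g)" 1]
    by (simp add: coset_homogeneous)
  finally show ?thesis .
qed

lemma H1_scale: "tvs_scale H1 a (coset (homogeneous b)) = coset (homogeneous (\<lambda>g. sc a (b g)))"
proof -
  have sum: "(\<lambda>x. sc a (homogeneous (\<lambda>g. b g + principal v g) x) + homogeneous (principal w) x) =
      homogeneous (\<lambda>g. sc a (b g) + principal (sc a v + w) g)" for v w
    by (rule ext)
      (simp add: homogeneous_add principal_add principal_scale scale_right_distrib add.assoc
        flip: homogeneous_scale)
  have "tvs_scale H1 a (coset (homogeneous b)) =
      {homogeneous (\<lambda>g. sc a (b g) + principal (sc a v + w) g) | v w. v \<in> W \<and> w \<in> W}"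
    unfolding cohomology_def coset_homogeneous coboundaries_eq by (auto simp flip: sum)
  also have "\<dots> = coset (homogeneous (\<lambda>g. sc a (b g)))"
    using W_combinations[of "\<lambda>u. homogeneous (\<lambda>g. sc a (b g) + principal u g)" a]
    by (simp add: coset_homogeneous)
  finally show ?thesis .
qed

text \<open>The saturation of an open set is a union of its translates by coboundaries, and
  translation preserves closeness on compact sets.\<close>

lemma open_map_coset: "open_map cocycle_topology (tvs_top H1) coset"
  unfolding open_map_def
proof (intro allI impI)
  fix S assume S: "openin cocycle_topology S"
  define S' where "S' = {f \<in> topspace cocycle_topology. coset f \<in> coset ` S}"
  have S_sub: "S \<subseteq> homogeneous ` crossed"
    using openin_subset[OF S] unfolding topspace_cocycle_topology .
  have "openin cocycle_topology S'"
  proof (rule open_cocyclesI)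
    show "S' \<subseteq> homogeneous ` crossed" unfolding S'_def topspace_cocycle_topology by blast
    fix b assume b: "b \<in> crossed" "homogeneous b \<in> S'"
    then obtain c where c: "c \<in> crossed" "homogeneous c \<in> S" "coset (homogeneous b) = coset (homogeneous c)"
      using S_sub unfolding S'_def by blast
    then obtain w where w: "w \<in> W" "\<And>g. b g = c g + principal w g" using coset_eq_iff by blast
    obtain K e where K: "compact K" "e > 0"
      "\<forall>d\<in>crossed. (\<forall>g\<in>K. norm (d g - c g) < e) \<longrightarrow> homogeneous d \<in> S"
      using open_cocyclesD[OF S c(2,1)] by blast
    have "homogeneous d \<in> S'" if d: "d \<in> crossed" "\<forall>g\<in>K. norm (d g - b g) < e" for d
    proof -
      have "homogeneous (\<lambda>g. d g - principal w g) \<in> S"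
        using d by (intro K(3)[rule_format] crossed_diff principal_crossed w(1))
          (simp_all add: w(2) algebra_simps)
      moreover have "coset (homogeneous d) = coset (homogeneous (\<lambda>g. d g - principal w g))"
        unfolding coset_eq_iff using w(1) by (intro bexI[of _ w]) simp_all
      ultimately show ?thesis using d(1) unfolding S'_def topspace_cocycle_topology by blast
    qed
    then show "\<exists>K e. compact K \<and> e > 0 \<and>
        (\<forall>d\<in>crossed. (\<forall>g\<in>K. norm (d g - b g) < e) \<longrightarrow> homogeneous d \<in> S')"
      using K(1,2) by blast
  qed
  moreover have "coset ` S \<subseteq> topspace (tvs_top H1)"
    using S_sub unfolding carrier_H1 by blast
  ultimately show "openin (tvs_top H1) (coset ` S)"
    using quotient_map_coset unfolding quotient_map_def S'_def by blast
qed

end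

section \<open>Modules over a product\<close>

lemma group_diff_continuous:
  "continuous_on UNIV (\<lambda>p :: 'a::topological_group_add \<times> 'a. - fst p + snd p)"
  unfolding continuous_on_def
  by (intro ballI tendsto_add tendsto_minus tendsto_fst tendsto_snd tendsto_ident_at)

lemma product_diff_continuous:
  "continuous_on UNIV (\<lambda>p :: ('a::topological_group_add \<times> 'b::topological_group_add) \<times> ('a \<times> 'b).
    - fst p + snd p)"
proof -
  have eq: "(\<lambda>p :: ('a \<times> 'b) \<times> ('a \<times> 'b). - fst p + snd p) =
      (\<lambda>p. (- fst (fst p) + fst (snd p), - snd (fst p) + snd (snd p)))"
    by (simp add: fun_eq_iff prod_eq_iff)
  have "continuous_on UNIV (\<lambda>p :: ('a \<times> 'b) \<times> ('a \<times> 'b). - fst (fst p) + fst (snd p))"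
    using continuous_on_compose2[OF group_diff_continuous,
        of UNIV "\<lambda>p :: ('a \<times> 'b) \<times> ('a \<times> 'b). (fst (fst p), fst (snd p))"]
    by (simp add: continuous_on_Pair continuous_on_fst continuous_on_snd continuous_on_id)
  moreover have "continuous_on UNIV (\<lambda>p :: ('a \<times> 'b) \<times> ('a \<times> 'b). - snd (fst p) + snd (snd p))"
    using continuous_on_compose2[OF group_diff_continuous,
        of UNIV "\<lambda>p :: ('a \<times> 'b) \<times> ('a \<times> 'b). (snd (fst p), snd (snd p))"]
    by (simp add: continuous_on_Pair continuous_on_fst continuous_on_snd continuous_on_id)
  ultimately show ?thesis unfolding eq by (rule continuous_on_Pair)
qed

locale product_module = banach_space sc
  for sc :: "'k::{real_normed_field, euclidean_space} \<Rightarrow> 'v::banach \<Rightarrow> 'v" +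
  fixes \<rho> :: "'g1::topological_group_add \<times> 'g2::topological_group_add \<Rightarrow> 'v \<Rightarrow> 'v"
    and \<mu>1 :: "'g1 measure" and \<mu>2 :: "'g2 measure" and C :: real
  assumes baire1: "baire_prob \<mu>1" and baire2: "baire_prob \<mu>2"
    and ub_product: "ub_module sc \<rho>" and cont_product: "strongly_continuous \<rho>"
    and stationary1: "weakly_uniquely_stationary sc \<mu>1 (restrict_fst \<rho>)"
    and no_ai: "\<not> almost_invariant_unit_vectors (restrict_fst \<rho>)"
    and stationary2: "weakly_uniquely_stationary sc \<mu>2 (restrict_snd \<rho>)"
    and C_ge_1: "C \<ge> 1" and bound_product: "norm (\<rho> g v) \<le> C * norm v"
begin

lemma cont_fst: "strongly_continuous (restrict_fst \<rho>)"
  and cont_snd: "strongly_continuous (restrict_snd \<rho>)"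
  unfolding strongly_continuous_def
  by (safe, rule continuous_on_compose2[where f = "\<lambda>g. (g, 0)" and t = UNIV],
      use cont_product in \<open>auto simp: strongly_continuous_def intro!: continuous_intros\<close>)
    (rule continuous_on_compose2[where f = "\<lambda>h. (0, h)" and t = UNIV],
      use cont_product in \<open>auto simp: strongly_continuous_def intro!: continuous_intros\<close>)

sublocale A1: averaged_module sc \<mu>1 "restrict_fst \<rho>" C
  by unfold_locales (use baire1 cont_fst stationary1 C_ge_1 bound_product in auto)

sublocale A2: averaged_module sc \<mu>2 "restrict_snd \<rho>" C
  by unfold_locales (use baire2 cont_snd stationary2 C_ge_1 bound_product in auto)

sublocale G: coefficient_module sc \<rho> UNIV C
  by unfold_locales
    (use product_diff_continuous ub_product cont_product C_ge_1 bound_product subspace_UNIV in auto)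

lemma action_commute: "\<rho> (0, h) (\<rho> (g, 0) v) = \<rho> (g, 0) (\<rho> (0, h) v)"
proof -
  have "\<rho> ((0, h) + (g, 0)) v = \<rho> ((g, 0) + (0, h)) v" by simp
  then show ?thesis by (simp only: G.action_simps)
qed

sublocale H: coefficient_module sc "restrict_fst \<rho>" A2.fixed C
  by unfold_locales
    (use group_diff_continuous A1.ub cont_fst C_ge_1 bound_product A2.fixed_scalar_subspace
      A2.fixed_invariant[OF G.bounded_linear_action action_commute] in auto)

sublocale K: coefficient_module sc "restrict_snd \<rho>" A1.fixed C
  by unfold_locales
    (use group_diff_continuous A2.ub cont_snd C_ge_1 bound_product A1.fixed_scalar_subspace
      A1.fixed_invariant[OF G.bounded_linear_action action_commute[symmetric]] in auto)

lemma P_equivariant: "A2.P (\<rho> (g, 0) v) = \<rho> (g, 0) (A2.P v)"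
  by (rule A2.P_commute[OF G.bounded_linear_action action_commute])

lemma P_bound: "norm (A2.P v) \<le> C * norm v"
  by (rule A2.averages_closure_bound[OF A2.P_in_closure])

text \<open>The negated definition, made homogeneous by normalising \<open>v\<close>. The bound
  \<open>r\<close> stands in for a supremum over \<open>K\<close>, and \<open>r \<ge> 0\<close>
  covers \<open>v = 0\<close>.\<close>

lemma spectral_gap:
  obtains K \<epsilon> where "compact K" "\<epsilon> > 0"
    "\<And>v r. r \<ge> 0 \<Longrightarrow> (\<And>k. k \<in> K \<Longrightarrow> norm (\<rho> (k, 0) v - v) \<le> r) \<Longrightarrow> \<epsilon> * norm v \<le> r"
proof -
  obtain K \<epsilon> where K: "compact K" "\<epsilon> > 0"
    "\<forall>v. \<not> (norm v = 1 \<and> (\<forall>g\<in>K. norm (v - \<rho> (g, 0) v) < \<epsilon>))"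
    using no_ai unfolding almost_invariant_unit_vectors_def by blast
  have "\<epsilon> * norm v \<le> r" if r: "r \<ge> 0" "\<And>k. k \<in> K \<Longrightarrow> norm (\<rho> (k, 0) v - v) \<le> r" for v r
  proof (cases "v = 0")
    case False
    let ?u = "(1 / norm v) *\<^sub>R v"
    have "norm ?u = 1" using False by simp
    then obtain k where k: "k \<in> K" "\<epsilon> \<le> norm (?u - \<rho> (k, 0) ?u)"
      using K(3)[rule_format, of ?u] by (auto simp: not_less)
    have "?u - \<rho> (k, 0) ?u = (1 / norm v) *\<^sub>R (v - \<rho> (k, 0) v)"
      using bounded_linear.linear[OF G.bounded_linear_action]
      by (simp add: linear_scale scaleR_diff_right)
    then have "\<epsilon> \<le> (1 / norm v) * norm (v - \<rho> (k, 0) v)" using k(2) by simp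
    then have "\<epsilon> * norm v \<le> norm (v - \<rho> (k, 0) v)" using False by (simp add: field_simps)
    then show ?thesis using r(2)[OF k(1)] by (simp add: norm_minus_commute)
  qed (use r in simp)
  with K(1,2) show thesis using that by blast
qed

section \<open>Averaging over the second factor\<close>

lemma crossed_split:
  assumes "b \<in> G.crossed"
  shows "b (g, h) = b (g, 0) + \<rho> (g, 0) (b (0, h))"
    and "\<rho> (g, 0) (b (0, h)) - b (0, h) = \<rho> (0, h) (b (g, 0)) - b (g, 0)"
proof -
  show *: "b (g, h) = b (g, 0) + \<rho> (g, 0) (b (0, h))" for g h
    using G.crossedD(3)[OF assms, of "(g, 0)" "(0, h)"] by simp
  have "b (g, h) = b (0, h) + \<rho> (0, h) (b (g, 0))"
    using G.crossedD(3)[OF assms, of "(0, h)" "(g, 0)"] by simp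
  then show "\<rho> (g, 0) (b (0, h)) - b (0, h) = \<rho> (0, h) (b (g, 0)) - b (g, 0)"
    using *[of g h] by (simp add: algebra_simps)
qed

text \<open>The condition on \<open>R\<close> is affine, since convex weights sum to 1, and for
  \<open>\<rho> (0, h)\<close> itself the vector \<open>b (0, h)\<close> is a solution.\<close>

lemma average_split:
  assumes R: "R \<in> A2.averages" and b: "b \<in> G.crossed"
  shows "\<exists>\<gamma>. \<forall>g. R (b (g, 0)) - b (g, 0) = \<rho> (g, 0) \<gamma> - \<gamma>"
  using R
proof (rule A2.averages_induct)
  show "convex {R. \<exists>\<gamma>. \<forall>g. blinfun_apply R (b (g, 0)) - b (g, 0) = \<rho> (g, 0) \<gamma> - \<gamma>}"
  proof (rule convexI)
    fix R Q and s t :: real assume st: "s + t = 1"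
    assume "R \<in> {R. \<exists>\<gamma>. \<forall>g. blinfun_apply R (b (g, 0)) - b (g, 0) = \<rho> (g, 0) \<gamma> - \<gamma>}"
      and "Q \<in> {R. \<exists>\<gamma>. \<forall>g. blinfun_apply R (b (g, 0)) - b (g, 0) = \<rho> (g, 0) \<gamma> - \<gamma>}"
    then obtain \<gamma> \<delta> where \<gamma>: "\<And>g. R (b (g, 0)) - b (g, 0) = \<rho> (g, 0) \<gamma> - \<gamma>"
      and \<delta>: "\<And>g. Q (b (g, 0)) - b (g, 0) = \<rho> (g, 0) \<delta> - \<delta>" by blast
    have "(s *\<^sub>R R + t *\<^sub>R Q) (b (g, 0)) - b (g, 0) =
        \<rho> (g, 0) (s *\<^sub>R \<gamma> + t *\<^sub>R \<delta>) - (s *\<^sub>R \<gamma> + t *\<^sub>R \<delta>)" for g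
    proof -
      have "(s *\<^sub>R R + t *\<^sub>R Q) (b (g, 0)) - b (g, 0) =
          (s *\<^sub>R R + t *\<^sub>R Q) (b (g, 0)) - (s + t) *\<^sub>R b (g, 0)" by (simp add: st)
      also have "\<dots> = s *\<^sub>R (R (b (g, 0)) - b (g, 0)) + t *\<^sub>R (Q (b (g, 0)) - b (g, 0))"
        by (simp add: blinfun.bilinear_simps algebra_simps)
      also have "\<dots> = s *\<^sub>R (\<rho> (g, 0) \<gamma> - \<gamma>) + t *\<^sub>R (\<rho> (g, 0) \<delta> - \<delta>)" by (simp only: \<gamma> \<delta>)
      finally show ?thesis
        using bounded_linear.linear[OF G.bounded_linear_action]
        by (simp add: linear_scale algebra_simps)
    qed
    then show "s *\<^sub>R R + t *\<^sub>R Q \<in>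
        {R. \<exists>\<gamma>. \<forall>g. blinfun_apply R (b (g, 0)) - b (g, 0) = \<rho> (g, 0) \<gamma> - \<gamma>}" by blast
  qed
  fix h
  show "\<exists>\<gamma>. \<forall>g. blinfun_apply (Blinfun (\<rho> (0, h))) (b (g, 0)) - b (g, 0) = \<rho> (g, 0) \<gamma> - \<gamma>"
    using crossed_split(2)[OF b] by (intro exI[of _ "b (0, h)"]) simp
qed

text \<open>Averages approximate the projection only pointwise, but uniformly on the compact image
  of a compact set \<open>L\<close> under \<open>b\<close>. For \<open>L\<close> containing
  \<open>K\<close> the gap makes the solutions \<gamma> of the approximating averages a Cauchy
  sequence.\<close>

lemma projection_split:
  assumes b: "b \<in> G.crossed"
  shows "\<exists>\<gamma>. \<forall>g. A2.P (b (g, 0)) - b (g, 0) = \<rho> (g, 0) \<gamma> - \<gamma>"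
proof -
  obtain K \<epsilon> where K: "compact K" "\<epsilon> > 0"
    and gap: "\<And>v r. r \<ge> 0 \<Longrightarrow> (\<And>k. k \<in> K \<Longrightarrow> norm (\<rho> (k, 0) v - v) \<le> r) \<Longrightarrow> \<epsilon> * norm v \<le> r"
    by (rule spectral_gap) blast
  have b_cont: "continuous_on S (\<lambda>g. b (g, 0))" for S
    by (rule continuous_on_compose2[OF G.crossedD(1)[OF b]]) (auto intro!: continuous_intros)
  have on_compact: "\<exists>\<gamma>. \<forall>g\<in>L. A2.P (b (g, 0)) - b (g, 0) = \<rho> (g, 0) \<gamma> - \<gamma>"
    if L: "compact L" "K \<subseteq> L" for L
  proof -
    have "compact ((\<lambda>g. b (g, 0)) ` L)" by (rule compact_continuous_image[OF b_cont L(1)])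
    note unif = sot_closure_uniform_on_compact[OF A2.P_in_closure A2.averages_bound _ this]
    have "\<exists>R\<in>A2.averages. \<forall>v\<in>(\<lambda>g. b (g, 0)) ` L. norm (blinfun_apply R v - A2.P v) < inverse (real (Suc n))" for n
      by (rule unif) (use C_ge_1 in auto)
    then have "\<exists>R\<in>A2.averages. \<forall>g\<in>L. norm (blinfun_apply R (b (g, 0)) - A2.P (b (g, 0))) < inverse (real (Suc n))" for n
      by (simp only: ball_simps)
    then obtain R where R: "\<And>n. R n \<in> A2.averages"
      "\<And>n g. g \<in> L \<Longrightarrow> norm (blinfun_apply (R n) (b (g, 0)) - A2.P (b (g, 0))) < inverse (real (Suc n))"
      by metis
    obtain \<gamma> where \<gamma>: "\<And>n g. blinfun_apply (R n) (b (g, 0)) - b (g, 0) = \<rho> (g, 0) (\<gamma> n) - \<gamma> n"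
      using average_split[OF R(1) b] by metis
    have "Cauchy \<gamma>"
    proof (rule metric_CauchyI)
      fix e :: real assume e: "e > 0"
      \<comment> \<open>Two errors below \<open>\<epsilon> * e / 3\<close> leave a strict margin
        once the gap is divided out.\<close>
      obtain N where N: "inverse (real (Suc N)) < \<epsilon> * e / 3"
        using reals_Archimedean[of "\<epsilon> * e / 3"] e K(2) by auto
      have "dist (\<gamma> m) (\<gamma> n) < e" if mn: "m \<ge> N" "n \<ge> N" for m n
      proof -
        have small: "inverse (real (Suc j)) < \<epsilon> * e / 3" if "j \<ge> N" for j
        proof -
          have "inverse (real (Suc j)) \<le> inverse (real (Suc N))"
            using that by (intro le_imp_inverse_le) auto
          then show ?thesis using N by linarith
        qed
        have "\<epsilon> * norm (\<gamma> m - \<gamma> n) \<le> 2 * (\<epsilon> * e / 3)"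
        proof (rule gap)
          fix k assume k: "k \<in> K"
          have "\<rho> (k, 0) (\<gamma> m - \<gamma> n) - (\<gamma> m - \<gamma> n) =
              (\<rho> (k, 0) (\<gamma> m) - \<gamma> m) - (\<rho> (k, 0) (\<gamma> n) - \<gamma> n)" by simp
          also have "\<dots> = (R m (b (k, 0)) - A2.P (b (k, 0))) - (R n (b (k, 0)) - A2.P (b (k, 0)))"
            by (simp add: \<gamma>[symmetric])
          finally have eq: "\<rho> (k, 0) (\<gamma> m - \<gamma> n) - (\<gamma> m - \<gamma> n) =
            (R m (b (k, 0)) - A2.P (b (k, 0))) - (R n (b (k, 0)) - A2.P (b (k, 0)))" .
          have "k \<in> L" using k L(2) by blast
          then show "norm (\<rho> (k, 0) (\<gamma> m - \<gamma> n) - (\<gamma> m - \<gamma> n)) \<le> 2 * (\<epsilon> * e / 3)"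
            unfolding eq
            using norm_triangle_ineq4[of "R m (b (k, 0)) - A2.P (b (k, 0))" "R n (b (k, 0)) - A2.P (b (k, 0))"]
              R(2)[of k m] R(2)[of k n] small[OF mn(1)] small[OF mn(2)] by linarith
        qed (use e K(2) in simp)
        also have "\<dots> < \<epsilon> * e" using e K(2) by simp
        finally show ?thesis using K(2) by (simp add: dist_norm)
      qed
      then show "\<exists>N. \<forall>m\<ge>N. \<forall>n\<ge>N. dist (\<gamma> m) (\<gamma> n) < e" by blast
    qed
    then obtain \<gamma>' where lim: "\<gamma> \<longlonglongrightarrow> \<gamma>'" using Cauchy_convergent convergent_def by blast
    have "A2.P (b (g, 0)) - b (g, 0) = \<rho> (g, 0) \<gamma>' - \<gamma>'" if g: "g \<in> L" for g
    proof -
      have "(\<lambda>n. R n (b (g, 0)) - A2.P (b (g, 0))) \<longlonglongrightarrow> 0"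
        by (rule Lim_null_comparison[OF _ LIMSEQ_inverse_real_of_nat])
          (intro always_eventually allI less_imp_le R(2)[OF g])
      then have "(\<lambda>n. R n (b (g, 0)) - b (g, 0)) \<longlonglongrightarrow> A2.P (b (g, 0)) - b (g, 0)"
        using tendsto_add[OF _ tendsto_const, of _ 0 sequentially "A2.P (b (g, 0)) - b (g, 0)"] by force
      moreover have "(\<lambda>n. \<rho> (g, 0) (\<gamma> n) - \<gamma> n) \<longlonglongrightarrow> \<rho> (g, 0) \<gamma>' - \<gamma>'"
        by (rule tendsto_diff[OF bounded_linear.tendsto[OF G.bounded_linear_action lim] lim])
      ultimately show ?thesis unfolding \<gamma> using LIMSEQ_unique by blast
    qed
    then show ?thesis by blast
  qed
  obtain \<gamma> where \<gamma>: "\<And>g. g \<in> K \<Longrightarrow> A2.P (b (g, 0)) - b (g, 0) = \<rho> (g, 0) \<gamma> - \<gamma>"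
    using on_compact[OF K(1) order_refl] by blast
  have "A2.P (b (g, 0)) - b (g, 0) = \<rho> (g, 0) \<gamma> - \<gamma>" for g
  proof -
    \<comment> \<open>The gap on \<open>K\<close> also makes solutions unique, so the solution
      obtained for \<open>insert g K\<close> is the one already fixed on \<open>K\<close>; hence a
      single vector serves every \<open>g\<close>.\<close>
    obtain \<delta> where \<delta>: "\<And>h. h \<in> insert g K \<Longrightarrow> A2.P (b (h, 0)) - b (h, 0) = \<rho> (h, 0) \<delta> - \<delta>"
      using on_compact[of "insert g K"] K(1) by auto
    have "\<epsilon> * norm (\<gamma> - \<delta>) \<le> 0"
    proof (rule gap)
      fix k assume k: "k \<in> K"
      have "\<rho> (k, 0) (\<gamma> - \<delta>) - (\<gamma> - \<delta>) = (\<rho> (k, 0) \<gamma> - \<gamma>) - (\<rho> (k, 0) \<delta> - \<delta>)" by simp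
      also have "\<dots> = 0" using \<gamma>[OF k] \<delta>[of k] k by simp
      finally show "norm (\<rho> (k, 0) (\<gamma> - \<delta>) - (\<gamma> - \<delta>)) \<le> 0" by simp
    qed simp
    then have "\<gamma> = \<delta>" using K(2) by (simp add: mult_le_0_iff)
    then show ?thesis using \<delta>[of g] by simp
  qed
  then show ?thesis by blast
qed

section \<open>Projection of crossed homomorphisms to the first factor\<close>

definition proj :: "('g1 \<times> 'g2 \<Rightarrow> 'v) \<Rightarrow> 'g1 \<Rightarrow> 'v"
  where "proj b = (\<lambda>g. A2.P (b (g, 0)))"

lemma proj_crossed: "b \<in> G.crossed \<Longrightarrow> proj b \<in> H.crossed"
proof -
  assume b: "b \<in> G.crossed"
  have "continuous_on UNIV (\<lambda>g. b (g, 0))"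
    by (rule continuous_on_compose2[OF G.crossedD(1)[OF b]]) (auto intro!: continuous_intros)
  then have "continuous_on UNIV (proj b)"
    unfolding proj_def by (rule bounded_linear.continuous_on[OF blinfun.bounded_linear_right])
  moreover have "b (g + h, 0) = b (g, 0) + \<rho> (g, 0) (b (h, 0))" for g h
    using G.crossedD(3)[OF b, of "(g, 0)" "(h, 0)"] by simp
  ultimately show ?thesis
    using A2.P_range by (auto simp: H.crossed_def proj_def blinfun.add_right P_equivariant)
qed

lemma proj_principal: "proj (\<lambda>g. b g + G.principal w g) = (\<lambda>g. proj b g + H.principal (A2.P w) g)"
  by (simp add: proj_def G.principal_def H.principal_def blinfun.bilinear_simps P_equivariant)

text \<open>These normalised representatives play the role of \<open>Z\<close> in
  \<open>embedding_map_quotient\<close>.\<close>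

definition split_crossed :: "('g1 \<times> 'g2 \<Rightarrow> 'v) set"
  where "split_crossed = {b \<in> G.crossed. \<forall>g. b (g, 0) \<in> A2.fixed}"

lemma proj_split: "b \<in> split_crossed \<Longrightarrow> proj b g = b (g, 0)"
  by (simp add: split_crossed_def proj_def A2.P_fixed)

text \<open>The principal correction replaces \<open>b\<close> on the first factor by its
  projection; since \<open>A2.P\<close> is idempotent, \<open>proj\<close> does not change.\<close>

lemma split_representative:
  assumes b: "b \<in> G.crossed"
  shows "\<exists>w. (\<lambda>g. b g + G.principal w g) \<in> split_crossed \<and>
    proj (\<lambda>g. b g + G.principal w g) = proj b"
proof -
  obtain w where "\<And>g. A2.P (b (g, 0)) - b (g, 0) = \<rho> (g, 0) w - w"
    using projection_split[OF b] by blast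
  then have eq: "b (g, 0) + G.principal w (g, 0) = A2.P (b (g, 0))" for g
    by (simp add: G.principal_def flip: diff_eq_eq) (simp add: algebra_simps)
  have "(\<lambda>g. b g + G.principal w g) \<in> split_crossed"
    using G.crossed_add[OF b G.principal_crossed] A2.P_range by (simp add: split_crossed_def eq)
  moreover have "proj (\<lambda>g. b g + G.principal w g) = proj b"
    by (simp add: proj_def eq A2.P_fixed[OF A2.P_range])
  ultimately show ?thesis by blast
qed

text \<open>By commutation \<open>(\<rho> (k, 0) - 1) (b (0, h)) = (\<rho> (0, h) - 1) (b (k, 0))\<close>, and the spectral gap
  turns a bound for this vector into one for \<open>b (0, h)\<close>.\<close>

lemma crossed_determined:
  obtains L B where "compact L" "B > 0"
    "\<And>b r g h. b \<in> G.crossed \<Longrightarrow> (\<And>k. k \<in> insert g L \<Longrightarrow> norm (b (k, 0)) \<le> r) \<Longrightarrow> r \<ge> 0 \<Longrightarrow>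
      norm (b (g, h)) \<le> B * r"
proof -
  obtain K \<epsilon> where K: "compact K" "\<epsilon> > 0"
    and gap: "\<And>v r. r \<ge> 0 \<Longrightarrow> (\<And>k. k \<in> K \<Longrightarrow> norm (\<rho> (k, 0) v - v) \<le> r) \<Longrightarrow> \<epsilon> * norm v \<le> r"
    by (rule spectral_gap) blast
  \<comment> \<open>The gap gives \<open>(C + 1) / \<epsilon>\<close> for \<open>b (0, h)\<close>;
    acting by \<open>(g, 0)\<close> costs a further \<open>C\<close>, and the summand 1 accounts for
    \<open>b (g, 0)\<close>.\<close>
  define B where "B = 1 + C * ((C + 1) / \<epsilon>)"
  have "B > 0" using C_ge_1 K(2) by (simp add: B_def add_pos_nonneg)
  moreover have "norm (b (g, h)) \<le> B * r"
    if b: "b \<in> G.crossed" and r: "\<And>k. k \<in> insert g K \<Longrightarrow> norm (b (k, 0)) \<le> r" "r \<ge> 0" for b r g h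
  proof -
    have "\<epsilon> * norm (b (0, h)) \<le> (C + 1) * r"
    proof (rule gap)
      fix k assume k: "k \<in> K"
      have "norm (\<rho> (k, 0) (b (0, h)) - b (0, h)) \<le> norm (\<rho> (0, h) (b (k, 0))) + norm (b (k, 0))"
        unfolding crossed_split(2)[OF b] by (rule norm_triangle_ineq4)
      also have "\<dots> \<le> C * norm (b (k, 0)) + norm (b (k, 0))" using bound_product by simp
      also have "\<dots> = (C + 1) * norm (b (k, 0))" by (simp add: algebra_simps)
      also have "\<dots> \<le> (C + 1) * r" using r(1)[of k] k C_ge_1 by (intro mult_left_mono) auto
      finally show "norm (\<rho> (k, 0) (b (0, h)) - b (0, h)) \<le> (C + 1) * r" .
    qed (use C_ge_1 r(2) in simp)
    then have "norm (b (0, h)) \<le> (C + 1) / \<epsilon> * r" using K(2) by (simp add: field_simps)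
    then have "C * norm (b (0, h)) \<le> C * ((C + 1) / \<epsilon> * r)"
      using C_ge_1 by (intro mult_left_mono) auto
    moreover have "norm (b (g, h)) \<le> norm (b (g, 0)) + norm (\<rho> (g, 0) (b (0, h)))"
      unfolding crossed_split(1)[OF b, of g h] by (rule norm_triangle_ineq)
    moreover have "norm (\<rho> (g, 0) (b (0, h))) \<le> C * norm (b (0, h))" by (rule bound_product)
    ultimately have "norm (b (g, h)) \<le> r + C * ((C + 1) / \<epsilon> * r)" using r(1)[of g] by simp
    then show ?thesis by (simp add: B_def algebra_simps)
  qed
  ultimately show thesis using that[OF K(1)] by blast
qed

section \<open>The induced map on first cohomology\<close>

definition proj_cocycle :: "((nat \<Rightarrow> 'g1 \<times> 'g2) \<Rightarrow> 'v) \<Rightarrow> (nat \<Rightarrow> 'g1) \<Rightarrow> 'v"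
  where "proj_cocycle f = H.homogeneous (proj (\<lambda>g. f (arg_pair 0 g)))"

lemma proj_cocycle_homogeneous [simp]:
  "proj_cocycle (G.homogeneous b) = H.homogeneous (proj b)"
  by (simp add: proj_cocycle_def)

lemma proj_cocycle_continuous: "continuous_map G.cocycle_topology H.cocycle_topology proj_cocycle"
  unfolding continuous_map_def
proof (intro conjI allI impI)
  show "proj_cocycle \<in> topspace G.cocycle_topology \<rightarrow> topspace H.cocycle_topology"
    unfolding G.topspace_cocycle_topology H.topspace_cocycle_topology using proj_crossed by auto
  fix U assume U: "openin H.cocycle_topology U"
  show "openin G.cocycle_topology {f \<in> topspace G.cocycle_topology. proj_cocycle f \<in> U}"
    unfolding G.topspace_cocycle_topology
  proof (rule G.open_cocyclesI)
    fix b assume b: "b \<in> G.crossed" "G.homogeneous b \<in> {f \<in> G.homogeneous ` G.crossed. proj_cocycle f \<in> U}"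
    then have "H.homogeneous (proj b) \<in> U" by simp
    from H.open_cocyclesD[OF U this proj_crossed[OF b(1)]]
    obtain K e where K: "compact K" "e > 0"
      "\<forall>c\<in>H.crossed. (\<forall>g\<in>K. norm (c g - proj b g) < e) \<longrightarrow> H.homogeneous c \<in> U" by blast
    have "compact ((\<lambda>g. (g, 0 :: 'g2)) ` K)"
      by (rule compact_continuous_image[OF _ K(1)]) (intro continuous_intros)
    moreover have "e / C > 0" using K(2) C_ge_1 by simp
    moreover have "H.homogeneous (proj c) \<in> U"
      if c: "c \<in> G.crossed" "\<forall>g\<in>(\<lambda>g. (g, 0)) ` K. norm (c g - b g) < e / C" for c
    proof -
      have "norm (proj c g - proj b g) < e" if g: "g \<in> K" for g
      proof -
        have "norm (proj c g - proj b g) \<le> C * norm (c (g, 0) - b (g, 0))"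
          using P_bound[of "c (g, 0) - b (g, 0)"] by (simp add: proj_def blinfun.diff_right)
        also have "\<dots> < C * (e / C)" using c(2) g C_ge_1 by (intro mult_strict_left_mono) auto
        finally show ?thesis using C_ge_1 by simp
      qed
      then show ?thesis using K(3) proj_crossed[OF c(1)] by blast
    qed
    ultimately show "\<exists>K e. compact K \<and> e > 0 \<and> (\<forall>c\<in>G.crossed. (\<forall>g\<in>K. norm (c g - b g) < e) \<longrightarrow>
        G.homogeneous c \<in> {f \<in> G.homogeneous ` G.crossed. proj_cocycle f \<in> U})"
      by (intro exI[of _ "(\<lambda>g. (g, 0)) ` K"] exI[of _ "e / C"]) simp
  qed blast
qed

definition T1 :: "((nat \<Rightarrow> 'g1 \<times> 'g2) \<Rightarrow> 'v) set \<Rightarrow> ((nat \<Rightarrow> 'g1) \<Rightarrow> 'v) set"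
  where "T1 U = H.coset (H.homogeneous (proj
    (SOME b. b \<in> G.crossed \<and> G.coset (G.homogeneous b) = U)))"

lemma T1_coset:
  assumes "b \<in> G.crossed"
  shows "T1 (G.coset (G.homogeneous b)) = H.coset (H.homogeneous (proj b))"
proof -
  define c where "c = (SOME c. c \<in> G.crossed \<and> G.coset (G.homogeneous c) = G.coset (G.homogeneous b))"
  have "c \<in> G.crossed \<and> G.coset (G.homogeneous c) = G.coset (G.homogeneous b)"
    unfolding c_def by (rule someI[of _ b]) (simp add: assms)
  then obtain w where "\<And>g. c g = b g + G.principal w g" using G.coset_eq_iff by blast
  then have "c = (\<lambda>g. b g + G.principal w g)" by blast
  then have "proj c g = proj b g + H.principal (A2.P w) g" for g by (simp add: proj_principal)
  then have "H.coset (H.homogeneous (proj c)) = H.coset (H.homogeneous (proj b))"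
    unfolding H.coset_eq_iff using A2.P_range by blast
  then show ?thesis by (simp add: T1_def c_def)
qed

text \<open>Normalisation provides the lifts. Fibres match because \<open>A2.P\<close> fixes
  \<open>A2.fixed\<close>, so a principal change of the projection comes from the principal
  homomorphism of the same vector. Injectivity and openness on normalised representatives are the
  estimate \<open>crossed_determined\<close> applied to differences.\<close>

lemma T1_embedding: "embedding_map (tvs_top G.H1) (tvs_top H.H1) T1"
proof (rule embedding_map_quotient[OF G.quotient_map_coset H.quotient_map_coset H.open_map_coset
      proj_cocycle_continuous, where Z = "G.homogeneous ` split_crossed"],
    unfold G.topspace_cocycle_topology H.topspace_cocycle_topology)
  show "T1 (G.coset x) = H.coset (proj_cocycle x)" if "x \<in> G.homogeneous ` G.crossed" for x
    using that T1_coset by auto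
  show "G.homogeneous ` split_crossed \<subseteq> G.homogeneous ` G.crossed" by (auto simp: split_crossed_def)
  show "\<exists>z\<in>G.homogeneous ` split_crossed. G.coset z = G.coset x \<and> proj_cocycle z = proj_cocycle x"
    if x: "x \<in> G.homogeneous ` G.crossed" for x
  proof -
    obtain b where b: "b \<in> G.crossed" "x = G.homogeneous b" using x by blast
    obtain w where w: "(\<lambda>g. b g + G.principal w g) \<in> split_crossed"
      "proj (\<lambda>g. b g + G.principal w g) = proj b" using split_representative[OF b(1)] by blast
    have "G.coset (G.homogeneous (\<lambda>g. b g + G.principal w g)) = G.coset x"
      unfolding b(2) G.coset_eq_iff by blast
    then show ?thesis
      using w by (intro bexI[of _ "G.homogeneous (\<lambda>g. b g + G.principal w g)"]) (simp_all add: b(2))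
  qed
  show "\<exists>x'\<in>G.homogeneous ` G.crossed. G.coset x' = G.coset x \<and> proj_cocycle x' = y"
    if x: "x \<in> G.homogeneous ` G.crossed" and y: "y \<in> H.homogeneous ` H.crossed"
      and eq: "H.coset y = H.coset (proj_cocycle x)" for x y
  proof -
    obtain b where b: "b \<in> G.crossed" "x = G.homogeneous b" using x by blast
    obtain c where c: "c \<in> H.crossed" "y = H.homogeneous c" using y by blast
    obtain w where w: "w \<in> A2.fixed" "\<And>g. c g = proj b g + H.principal w g"
      using eq unfolding b(2) c(2) proj_cocycle_homogeneous H.coset_eq_iff by blast
    let ?b = "\<lambda>g. b g + G.principal w g"
    have "proj ?b = c" using w A2.P_fixed[OF w(1)] by (simp add: proj_principal fun_eq_iff)
    moreover have "G.coset (G.homogeneous ?b) = G.coset x" unfolding b(2) G.coset_eq_iff by blast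
    moreover have "?b \<in> G.crossed" by (intro G.crossed_add b(1) G.principal_crossed UNIV_I)
    ultimately show ?thesis using c(2) by (intro bexI[of _ "G.homogeneous ?b"]) simp_all
  qed
  obtain L B where L: "compact L" "B > 0"
    and det: "\<And>b r g h. b \<in> G.crossed \<Longrightarrow> (\<And>k. k \<in> insert g L \<Longrightarrow> norm (b (k, 0)) \<le> r) \<Longrightarrow> r \<ge> 0 \<Longrightarrow>
      norm (b (g, h)) \<le> B * r"
    by (rule crossed_determined) blast
  have split: "b \<in> G.crossed" if "b \<in> split_crossed" for b using that by (simp add: split_crossed_def)
  show "inj_on proj_cocycle (G.homogeneous ` split_crossed)"
  proof (rule inj_onI)
    fix x y assume "x \<in> G.homogeneous ` split_crossed" "y \<in> G.homogeneous ` split_crossed"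
      and eq: "proj_cocycle x = proj_cocycle y"
    then obtain b c where bc: "b \<in> split_crossed" "x = G.homogeneous b" "c \<in> split_crossed" "y = G.homogeneous c"
      by blast
    then have "proj b = proj c" using eq by (simp add: H.homogeneous_inject)
    then have agree: "b (g, 0) = c (g, 0)" for g
      using proj_split[OF bc(1), of g] proj_split[OF bc(3), of g] by simp
    have "norm (b (g, h) - c (g, h)) \<le> B * 0" for g h
      by (rule det[OF G.crossed_diff[OF split[OF bc(1)] split[OF bc(3)]]]) (simp_all add: agree)
    then have "b = c" by auto
    then show "x = y" by (simp add: bc)
  qed
  fix S z assume S: "openin G.cocycle_topology S" and z: "z \<in> G.homogeneous ` split_crossed" "z \<in> S"
  then obtain b where b: "b \<in> split_crossed" "z = G.homogeneous b" by blast
  obtain K e where K: "compact K" "e > 0"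
    "\<forall>c\<in>G.crossed. (\<forall>g\<in>K. norm (c g - b g) < e) \<longrightarrow> G.homogeneous c \<in> S"
    using G.open_cocyclesD[OF S _ split[OF b(1)]] z(2) b(2) by blast
  define r where "r = e / (2 * B)"
  have "r > 0" using K(2) L(2) by (simp add: r_def)
  have "compact (fst ` K)" by (rule compact_continuous_image[OF _ K(1)]) (intro continuous_intros)
  then have "compact (fst ` K \<union> L)" using L(1) by (rule compact_Un)
  from H.cocycle_neighbourhood[OF proj_crossed[OF split[OF b(1)]] this \<open>r > 0\<close>]
  obtain N where N: "openin H.cocycle_topology N" "H.homogeneous (proj b) \<in> N"
    "\<forall>c. H.homogeneous c \<in> N \<longrightarrow> (\<forall>g\<in>fst ` K \<union> L. norm (c g - proj b g) < r)" by blast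
  have "G.homogeneous c \<in> S" if c: "c \<in> split_crossed" "H.homogeneous (proj c) \<in> N" for c
  proof -
    have near: "norm (c (g, 0) - b (g, 0)) \<le> r" if "g \<in> fst ` K \<union> L" for g
      using N(3) c(2) that proj_split[OF b(1), of g] proj_split[OF c(1), of g] by (metis less_imp_le)
    have "norm (c p - b p) < e" if p: "p \<in> K" for p
    proof -
      have "norm (c (fst p, snd p) - b (fst p, snd p)) \<le> B * r"
        by (rule det[OF G.crossed_diff[OF split[OF c(1)] split[OF b(1)]]])
          (use near p \<open>r > 0\<close> in auto)
      also have "\<dots> < e" using K(2) L(2) by (simp add: r_def)
      finally show ?thesis by simp
    qed
    then show ?thesis using K(3) split[OF c(1)] by blast
  qed
  then show "\<exists>R. openin H.cocycle_topology R \<and> proj_cocycle z \<in> R \<and>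
      (\<forall>z'\<in>G.homogeneous ` split_crossed. proj_cocycle z' \<in> R \<longrightarrow> z' \<in> S)"
    using N(1,2) by (intro exI[of _ N]) (auto simp: b(2))
qed

lemma T1_carrier: "T1 ` tvs_carrier G.H1 \<subseteq> tvs_carrier H.H1"
  unfolding G.carrier_H1 H.carrier_H1 using T1_coset proj_crossed by auto

lemma T1_linear: "tvs_linear G.H1 H.H1 T1"
  unfolding tvs_linear_def
proof (intro conjI ballI allI T1_carrier)
  fix x y assume "x \<in> tvs_carrier G.H1" "y \<in> tvs_carrier G.H1"
  then obtain b c where b: "b \<in> G.crossed" "x = G.coset (G.homogeneous b)"
    and c: "c \<in> G.crossed" "y = G.coset (G.homogeneous c)" unfolding G.carrier_H1 by blast
  have "proj (\<lambda>g. b g + c g) = (\<lambda>g. proj b g + proj c g)" by (simp add: proj_def blinfun.add_right)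
  then show "T1 (tvs_add G.H1 x y) = tvs_add H.H1 (T1 x) (T1 y)"
    by (simp add: b c G.H1_add H.H1_add T1_coset G.crossed_add)
next
  fix a x assume "x \<in> tvs_carrier G.H1"
  then obtain b where b: "b \<in> G.crossed" "x = G.coset (G.homogeneous b)" unfolding G.carrier_H1 by blast
  have "proj (\<lambda>g. sc a (b g)) = (\<lambda>g. sc a (proj b g))" by (simp add: proj_def A2.P_scale)
  then show "T1 (tvs_scale G.H1 a x) = tvs_scale H.H1 a (T1 x)"
    by (simp add: b G.H1_scale H.H1_scale T1_coset G.crossed_scale)
qed

lemma T1_surj:
  assumes "A2.fixed = fixed_vectors (restrict_snd \<rho>)"
  shows "T1 ` tvs_carrier G.H1 = tvs_carrier H.H1"
proof
  show "tvs_carrier H.H1 \<subseteq> T1 ` tvs_carrier G.H1"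
  proof
    fix y assume "y \<in> tvs_carrier H.H1"
    then obtain c where c: "c \<in> H.crossed" "y = H.coset (H.homogeneous c)"
      unfolding H.carrier_H1 by blast
    \<comment> \<open>Inflation along the projection to the first factor; it is a crossed
      homomorphism because the second factor fixes the values of \<open>c\<close>.\<close>
    define b where "b = (\<lambda>p :: 'g1 \<times> 'g2. c (fst p))"
    have inv: "\<rho> (0, h) (c g) = c g" for g h
      using H.crossedD(2)[OF c(1), of g] assms by (simp add: fixed_vectors_def)
    have flat: "\<rho> (g, h) (c k) = \<rho> (g, 0) (c k)" for g h k
      using G.action_simps(1)[of "(g, 0)" "(0, h)" "c k"] by (simp add: inv)
    have "b (p + q) = b p + \<rho> p (b q)" for p q
      using H.crossedD(3)[OF c(1), of "fst p" "fst q"] flat[of "fst p" "snd p" "fst q"]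
      by (simp add: b_def)
    moreover have "continuous_on UNIV b" unfolding b_def
      by (rule continuous_on_compose2[OF H.crossedD(1)[OF c(1)]]) (auto intro!: continuous_intros)
    ultimately have "b \<in> G.crossed" unfolding G.crossed_def by blast
    moreover have "proj b = c"
      using A2.P_fixed[OF H.crossedD(2)[OF c(1)]] by (simp add: proj_def b_def)
    ultimately have "y = T1 (G.coset (G.homogeneous b))" by (simp add: T1_coset c(2))
    then show "y \<in> T1 ` tvs_carrier G.H1" unfolding G.carrier_H1 using \<open>b \<in> G.crossed\<close> by blast
  qed
qed (rule T1_carrier)

section \<open>The second summand and surjectivity\<close>

lemma zero_crossed: "(\<lambda>_. 0) \<in> K.crossed"
  using subspace_0[OF K.W_subspace] by (simp add: K.crossed_def)

definition zero_class :: "((nat \<Rightarrow> 'g2) \<Rightarrow> 'v) set"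
  where "zero_class = K.coset (K.homogeneous (\<lambda>_. 0))"

text \<open>The component in the second summand can be taken to be zero, since by the spectral gap a
  crossed homomorphism is already determined by its restriction to \<open>G\<^sub>1\<close>.\<close>

definition T :: "((nat \<Rightarrow> 'g1 \<times> 'g2) \<Rightarrow> 'v) set \<Rightarrow> ((nat \<Rightarrow> 'g1) \<Rightarrow> 'v) set \<times> ((nat \<Rightarrow> 'g2) \<Rightarrow> 'v) set"
  where "T U = (T1 U, zero_class)"

lemma zero_class_carrier: "zero_class \<in> tvs_carrier K.H1"
  unfolding K.carrier_H1 zero_class_def using zero_crossed by blast

lemma T_embedding: "tvs_embedding G.H1 (tvs_sum H.H1 K.H1) T"
proof -
  have "tvs_linear G.H1 (tvs_sum H.H1 K.H1) T"
    using T1_linear zero_class_carrier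
    by (auto simp: tvs_linear_def tvs_sum_def T_def zero_class_def K.H1_add K.H1_scale)
  \<comment> \<open>A slice at a fixed second coordinate is the graph of a constant map, hence an
    embedding.\<close>
  moreover have "embedding_map (tvs_top H.H1) (prod_topology (tvs_top H.H1) (tvs_top K.H1)) (\<lambda>x. (x, zero_class))"
    using zero_class_carrier by (simp add: embedding_map_graph)
  then have "embedding_map (tvs_top G.H1) (prod_topology (tvs_top H.H1) (tvs_top K.H1)) ((\<lambda>x. (x, zero_class)) \<circ> T1)"
    by (rule embedding_map_compose[OF T1_embedding])
  then have "embedding_map (tvs_top G.H1) (tvs_top (tvs_sum H.H1 K.H1)) T"
    by (simp add: tvs_sum_def T_def[abs_def] o_def)
  ultimately show ?thesis by (simp add: tvs_embedding_def)
qed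

text \<open>A fixed vector has zero displacement on \<open>K\<close>, so the gap forces it to
  vanish. When stationary and fixed vectors of the first factor agree, this makes the second summand
  zero.\<close>

lemma fixed_fst_trivial: "fixed_vectors (restrict_fst \<rho>) \<subseteq> {0}"
proof
  fix v assume v: "v \<in> fixed_vectors (restrict_fst \<rho>)"
  obtain K \<epsilon> where K: "\<epsilon> > 0"
    and gap: "\<And>v r. r \<ge> 0 \<Longrightarrow> (\<And>k. k \<in> K \<Longrightarrow> norm (\<rho> (k, 0) v - v) \<le> r) \<Longrightarrow> \<epsilon> * norm v \<le> r"
    by (rule spectral_gap) blast
  have "\<epsilon> * norm v \<le> 0" by (rule gap) (use v in \<open>simp_all add: fixed_vectors_def\<close>)
  then show "v \<in> {0}" using K by (simp add: mult_le_0_iff)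
qed

lemma T_surj:
  assumes "A1.fixed = fixed_vectors (restrict_fst \<rho>)" "A2.fixed = fixed_vectors (restrict_snd \<rho>)"
  shows "T ` tvs_carrier G.H1 = tvs_carrier (tvs_sum H.H1 K.H1)"
proof -
  have "b = (\<lambda>_. 0)" if "b \<in> K.crossed" for b
    using K.crossedD(2)[OF that] fixed_fst_trivial assms(1) by blast
  then have "tvs_carrier K.H1 = {zero_class}"
    using zero_crossed unfolding K.carrier_H1 zero_class_def by blast
  then have "tvs_carrier (tvs_sum H.H1 K.H1) = tvs_carrier H.H1 \<times> {zero_class}"
    by (simp add: tvs_sum_def)
  also have "\<dots> = T ` tvs_carrier G.H1"
    unfolding T1_surj[OF assms(2), symmetric] T_def by auto
  finally show ?thesis by simp
qed

lemma T1_isomorphism: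
  assumes "A2.fixed = fixed_vectors (restrict_snd \<rho>)"
  shows "tvs_isomorphic G.H1 H.H1"
proof -
  have "homeomorphic_map (tvs_top G.H1) (tvs_top H.H1) T1"
    using T1_embedding unfolding embedding_map_def T1_surj[OF assms] by simp
  then show ?thesis unfolding tvs_isomorphic_def using T1_linear by blast
qed

end

theorem theorem3:
  fixes sc :: "'k::{real_normed_field, euclidean_space} \<Rightarrow> 'v::banach \<Rightarrow> 'v"
    and \<rho> :: "'g1::topological_group_add \<times> 'g2::topological_group_add \<Rightarrow> 'v \<Rightarrow> 'v"
    and \<mu>1 :: "'g1 measure" and \<mu>2 :: "'g2 measure"
  assumes "banach_space sc"
    and "baire_prob \<mu>1" and "baire_prob \<mu>2"
    and "ub_module sc \<rho>" and "strongly_continuous \<rho>"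
    and "weakly_uniquely_stationary sc \<mu>1 (restrict_fst \<rho>)"
    and "\<not> almost_invariant_unit_vectors (restrict_fst \<rho>)"
    and "weakly_uniquely_stationary sc \<mu>2 (restrict_snd \<rho>)"
  shows "\<exists>T. tvs_embedding (cohomology sc 1 UNIV \<rho>)
             (tvs_sum (cohomology sc 1 (stationary_vectors sc \<mu>2 (restrict_snd \<rho>)) (restrict_fst \<rho>))
                      (cohomology sc 1 (stationary_vectors sc \<mu>1 (restrict_fst \<rho>)) (restrict_snd \<rho>))) T \<and>
           (stationary_vectors sc \<mu>1 (restrict_fst \<rho>) = fixed_vectors (restrict_fst \<rho>) \<and>
            stationary_vectors sc \<mu>2 (restrict_snd \<rho>) = fixed_vectors (restrict_snd \<rho>) \<longrightarrow>
              T ` tvs_carrier (cohomology sc 1 UNIV \<rho>) =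
                tvs_carrier (tvs_sum (cohomology sc 1 (stationary_vectors sc \<mu>2 (restrict_snd \<rho>)) (restrict_fst \<rho>))
                                     (cohomology sc 1 (stationary_vectors sc \<mu>1 (restrict_fst \<rho>)) (restrict_snd \<rho>))) \<and>
              tvs_isomorphic (cohomology sc 1 UNIV \<rho>)
                             (cohomology sc 1 (fixed_vectors (restrict_snd \<rho>)) (restrict_fst \<rho>)))"
proof -
  obtain C where C: "C \<ge> 1" "\<And>g v. norm (\<rho> g v) \<le> C * norm v"
    using ub_module_bound[OF assms(4)] by blast
  interpret banach_space sc by fact
  interpret product_module sc \<rho> \<mu>1 \<mu>2 C
    by unfold_locales (use assms C in auto)
  show ?thesis
    unfolding A1.fixed_eq A2.fixed_eq
  proof (intro exI conjI impI)
    show "tvs_embedding G.H1 (tvs_sum H.H1 K.H1) T" by (rule T_embedding)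
  next
    assume *: "A1.fixed = fixed_vectors (restrict_fst \<rho>) \<and> A2.fixed = fixed_vectors (restrict_snd \<rho>)"
    then show "T ` tvs_carrier G.H1 = tvs_carrier (tvs_sum H.H1 K.H1)" by (intro T_surj) auto
    show "tvs_isomorphic G.H1 (cohomology sc 1 (fixed_vectors (restrict_snd \<rho>)) (restrict_fst \<rho>))"
      using T1_isomorphism * by simp
  qed
qed

end
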